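(* Let $N\in\mathbb{N}$, $n\in\{1,\dots,N\}$ with $\frac{n}{N}<1$, let $(S,\mathcal{S})$ be a measurable space, $(\Omega,\mathcal{A},P)$ a probability space, and let $X_1,\dots,X_N:\Omega\to S$ be random variables such that $(X_1,\dots,X_N)$ is exchangeable. Write $Y_n=(X_1,\dots,X_n)$ and let $P^{Y_n}$ be its distribution on $(S^n,\mathcal{S}^{\otimes n})$. Let $\mathcal{F}_n$, $Q_1$ and (for $n\ge 2$) $Q_2$ be as defined in the context. Then $$\sup_{f\in\mathcal{F}_n}\Big|\int f\,\mathrm{d}(P^{Y_n}-Q_1)\Big|\leq \frac{n}{N}+2.12\,\frac{(\frac{n}{N})^{3/2}}{(1-\frac{n}{N})^{3/4}},$$ and, if $n\geq 2$, $$\sup_{f\in\mathcal{F}_n}\Big|\int f\,\mathrm{d}(P^{Y_n}-Q_2)\Big|\leq \sqrt{3}\Big(\frac{n}{N}\Big)^{3/2}+2.27\,\frac{(\frac{n}{N})^{2}}{(1-\frac{n}{N})^{3/4}}.$$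
   Context: $\mathbb{N}=\{1,2,\dots\}$. Exchangeable means that the distribution of $(X_1,\dots,X_N)$ on $(S^N,\mathcal{S}^{\otimes N})$ is invariant under permutations of the coordinates. $\mathcal{F}_n$ is the set of all functions $f:S^n\to\mathbb{C}$ for which there exist measurable functions $f_1,\dots,f_n:S\to\mathbb{C}$ with $|f_k(s)|\le 1$ for all $s\in S$ and $k\in\{1,\dots,n\}$, such that $f(x)=\prod_{k=1}^n f_k(x_k)$ for all $x=(x_1,\dots,x_n)\in S^n$. $\delta_x$ denotes the Dirac measure at $x\in S$. $Q_1$ is the probability measure on $(S^n,\mathcal{S}^{\otimes n})$ given by $$Q_1(A)=\int\Big(\frac1N\sum_{j=1}^N\delta_{X_j(\omega)}\Big)^{\otimes n}(A)\,\mathrm{d}P(\omega),\qquad A\in\mathcal{S}^{\otimes n}.$$ For $n\ge2$ (hence $N\geq 2$), $Q_2$ is the finite signed measure on $(S^n,\mathcal{S}^{\otimes n})$ given by $$Q_2(A)=Q_1(A)-\frac{1}{N(N-1)}\sum_{K\subseteq\{1,\dots,n\}:\,|K|=2}\ \sum_{j=1}^N\int\Big(\bigotimes_{k=1}^n R_{j,k,K}(\omega)\Big)(A)\,\mathrm{d}P(\omega),\qquad A\in\mathcal{S}^{\otimes n},$$ where $R_{j,k,K}(\omega)=\delta_{X_j(\omega)}-\frac1N\sum_{\ell=1}^N\delta_{X_\ell(\omega)}$ if $k\in K$, and $R_{j,k,K}(\omega)=\frac1N\sum_{\ell=1}^N\delta_{X_\ell(\omega)}$ if $k\in\{1,\dots,n\}\setminus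 K$ (products of finite signed measures are understood). *)

theory Defs
  imports "HOL-Probability.Probability"
begin

text \<open>
  Finite signed measures on \<open>M\<close> are represented as real-valued set functions. As for the
  library's \<^const>\<open>measure\<close>, the value outside \<open>sets M\<close> is fixed to be 0, so that a signed
  measure is determined by its values on measurable sets.
\<close>

definition finite_signed_measure :: "'a measure \<Rightarrow> ('a set \<Rightarrow> real) \<Rightarrow> bool" where
  "finite_signed_measure M \<nu> \<longleftrightarrow>
     \<nu> {} = 0 \<and>
     (\<forall>A :: nat \<Rightarrow> 'a set. range A \<subseteq> sets M \<longrightarrow> disjoint_family A \<longrightarrow>
        (\<lambda>i. \<nu> (A i)) sums \<nu> (\<Union>i. A i)) \<and>
     (\<forall>A. A \<notin> sets M \<longrightarrow> \<nu> A = 0)"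

text \<open>
  Positive part in the Jordan decomposition: the upper variation, mapping \<open>A\<close> to the supremum of
  \<open>\<nu> B\<close> over measurable \<open>B \<subseteq> A\<close>. Truncation of negative values by \<^const>\<open>ennreal\<close> is
  harmless because \<open>B = {}\<close> contributes 0. The negative part is the upper variation of \<open>- \<nu>\<close>.
\<close>

definition upper_variation :: "'a measure \<Rightarrow> ('a set \<Rightarrow> real) \<Rightarrow> 'a measure" where
  "upper_variation M \<nu> =
     measure_of (space M) (sets M) (\<lambda>A. SUP B\<in>{B \<in> sets M. B \<subseteq> A}. ennreal (\<nu> B))"

definition signed_integral :: "'a measure \<Rightarrow> ('a set \<Rightarrow> real) \<Rightarrow> ('a \<Rightarrow> complex) \<Rightarrow> complex" where
  "signed_integral M \<nu> f =
     integral\<^sup>L (upper_variation M \<nu>) f - integral\<^sup>L (upper_variation M (\<lambda>A. - \<nu> A)) f"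

definition signed_product ::
    "'i set \<Rightarrow> ('i \<Rightarrow> 'a measure) \<Rightarrow> ('i \<Rightarrow> 'a set \<Rightarrow> real) \<Rightarrow> ('i \<Rightarrow> 'a) set \<Rightarrow> real" where
  "signed_product I M \<nu> =
     (THE \<mu>. finite_signed_measure (Pi\<^sub>M I M) \<mu> \<and>
        (\<forall>A \<in> (\<Pi> k\<in>I. sets (M k)). \<mu> (Pi\<^sub>E I A) = (\<Prod>k\<in>I. \<nu> k (A k))))"

text \<open>
  Throughout, random variables are indexed by \<open>{1..N}\<close>, and \<open>S\<^sup>n\<close> with its product sigma-algebra
  is \<open>Pi\<^sub>M {1..n} (\<lambda>_. S)\<close>.
\<close>

definition tuple :: "(nat \<Rightarrow> 'w \<Rightarrow> 's) \<Rightarrow> nat \<Rightarrow> 'w \<Rightarrow> nat \<Rightarrow> 's" where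
  "tuple X n \<omega> = (\<lambda>i\<in>{1..n}. X i \<omega>)"

definition exchangeable ::
    "'w measure \<Rightarrow> 's measure \<Rightarrow> nat \<Rightarrow> (nat \<Rightarrow> 'w \<Rightarrow> 's) \<Rightarrow> bool" where
  "exchangeable P S N X \<longleftrightarrow>
     (\<forall>\<pi>. \<pi> permutes {1..N} \<longrightarrow>
        distr P (Pi\<^sub>M {1..N} (\<lambda>_. S)) (tuple (\<lambda>i. X (\<pi> i)) N) =
        distr P (Pi\<^sub>M {1..N} (\<lambda>_. S)) (tuple X N))"

text \<open>
  The values of a function on \<open>S\<^sup>n\<close> outside the carrier of the product space are left arbitrary;
  they do not affect integrals.
\<close>

definition product_functions :: "'s measure \<Rightarrow> nat \<Rightarrow> ((nat \<Rightarrow> 's) \<Rightarrow> complex) set" where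
  "product_functions S n =
     {f. \<exists>g :: nat \<Rightarrow> 's \<Rightarrow> complex.
        (\<forall>k\<in>{1..n}. g k \<in> borel_measurable S \<and> (\<forall>s\<in>space S. norm (g k s) \<le> 1)) \<and>
        (\<forall>x\<in>space (Pi\<^sub>M {1..n} (\<lambda>_. S)). f x = (\<Prod>k=1..n. g k (x k)))}"

definition dirac :: "'s measure \<Rightarrow> 's \<Rightarrow> 's set \<Rightarrow> real" where
  "dirac S x = measure (return S x)"

definition empirical ::
    "'s measure \<Rightarrow> nat \<Rightarrow> (nat \<Rightarrow> 'w \<Rightarrow> 's) \<Rightarrow> 'w \<Rightarrow> 's set \<Rightarrow> real" where
  "empirical S N X \<omega> A = 1 / real N * (\<Sum>j=1..N. dirac S (X j \<omega>) A)"

definition Q1 ::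
    "'w measure \<Rightarrow> 's measure \<Rightarrow> nat \<Rightarrow> nat \<Rightarrow> (nat \<Rightarrow> 'w \<Rightarrow> 's) \<Rightarrow> (nat \<Rightarrow> 's) set \<Rightarrow> real" where
  "Q1 P S N n X A =
     (\<integral>\<omega>. signed_product {1..n} (\<lambda>_. S) (\<lambda>_. empirical S N X \<omega>) A \<partial>P)"

definition R ::
    "'s measure \<Rightarrow> nat \<Rightarrow> (nat \<Rightarrow> 'w \<Rightarrow> 's) \<Rightarrow> nat \<Rightarrow> nat set \<Rightarrow> 'w \<Rightarrow> nat \<Rightarrow> 's set \<Rightarrow> real" where
  "R S N X j K \<omega> k =
     (if k \<in> K then (\<lambda>A. dirac S (X j \<omega>) A - empirical S N X \<omega> A) else empirical S N X \<omega>)"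

definition Q2 ::
    "'w measure \<Rightarrow> 's measure \<Rightarrow> nat \<Rightarrow> nat \<Rightarrow> (nat \<Rightarrow> 'w \<Rightarrow> 's) \<Rightarrow> (nat \<Rightarrow> 's) set \<Rightarrow> real" where
  "Q2 P S N n X A =
     Q1 P S N n X A -
     1 / (real N * (real N - 1)) *
       (\<Sum>K\<in>{K. K \<subseteq> {1..n} \<and> card K = 2}. \<Sum>j=1..N.
          (\<integral>\<omega>. signed_product {1..n} (\<lambda>_. S) (R S N X j K \<omega>) A \<partial>P))"

end

theory Submission
  imports Defs
begin

text \<open>
  Fix \<open>\<omega>\<close>, a product function with factors \<open>g\<^sub>k\<close>, and put \<open>z\<^sub>k(j) = g\<^sub>k(X\<^sub>j(\<omega>))\<close>. Let \<open>m\<^sub>k\<close> be the mean of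
  \<open>z\<^sub>k\<close> over \<open>j = 1..N\<close>, \<open>y\<^sub>k = z\<^sub>k - m\<^sub>k\<close>, and \<open>v\<^sub>k\<close> the root mean square of \<open>y\<^sub>k\<close>; then
  \<open>|m\<^sub>k|\<^sup>2 + v\<^sub>k\<^sup>2 \<le> 1\<close>. By exchangeability, the integral of \<open>f\<close> against the law of
  \<open>(X\<^sub>1,\<dots>,X\<^sub>n)\<close> is the expectation of the average of \<open>\<Prod>\<^sub>k z\<^sub>k(j\<^sub>k)\<close> over all tuples of distinct
  indices, that is, of a normalised permanent. Expanding \<open>z\<^sub>k = m\<^sub>k + y\<^sub>k\<close>, this average is the sum
  over \<open>K \<subseteq> {1..n}\<close> of \<open>T(K) \<Prod>\<^sub>k\<^sub>\<notin>\<^sub>K m\<^sub>k\<close>, where \<open>T(K)\<close> is the normalised permanent of the centred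
  columns \<open>y\<^sub>k\<close>, \<open>k \<in> K\<close>. The empty set contributes the integrand of \<open>Q1\<close>, singletons contribute
  0, and the two-element sets contribute exactly the correction that defines \<open>Q2\<close>. Both claims
  are therefore deterministic bounds, for the sums over \<open>|K| \<ge> 2\<close> and \<open>|K| \<ge> 3\<close> respectively.

  The heart of the matter is a bound \<open>|T(K)| \<le> b\<^sub>r \<Prod>\<^sub>k\<^sub>\<in>\<^sub>K v\<^sub>k\<close> for \<open>|K| = r\<close>
  (\<open>permanent_bound\<close>). If all columns are equal to \<open>y\<close>, then \<open>T(K)\<close> is a normalised coefficient
  of \<open>\<Prod>\<^sub>j (1 + t y\<^sub>j)\<close>; as \<open>y\<close> has sum 0, the inequality of arithmetic and geometric means bounds
  this polynomial by \<open>(1 + |t|\<^sup>2 v\<^sup>2)\<^bsup>N/2\<^esup>\<close>, and one optimises over \<open>|t|\<close>. Passing from equal to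
  arbitrary columns costs nothing: over a complex Hilbert space a symmetric multilinear form has
  the same norm as its restriction to the diagonal (Banach). This is \<open>symmetric_form_bound\<close>,
  and it rests on a quadrature rule with positive weights at the \<open>r\<close>-th roots of \<open>-1\<close>.

  Given the bound, the Cauchy-Schwarz inequality over \<open>K\<close> and
  \<open>\<Sum>\<^sub>K \<Prod>\<^sub>k\<^sub>\<in>\<^sub>K v\<^sub>k\<^sup>2 \<Prod>\<^sub>k\<^sub>\<notin>\<^sub>K |m\<^sub>k|\<^sup>2 \<le> 1\<close> reduce everything to \<open>\<Sum>\<^sub>r (n choose r) b\<^sub>r\<^sup>2\<close>. With
  \<open>\<alpha> = n/N\<close> and \<open>s(r) = r! e\<^sup>r / r\<^sup>r\<close> one has \<open>(n choose r) b\<^sub>r\<^sup>2 \<le> s(r) \<alpha>\<^sup>r\<close>, and \<open>s\<close> grows no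
  faster than the coefficients of \<open>(1 - x)\<^bsup>-3/2\<^esup>\<close>. So the sum over \<open>r \<ge> r\<^sub>0\<close> is at most
  \<open>s(r\<^sub>0) \<alpha>\<^bsup>r\<^sub>0\<^esup> (1 - \<alpha>)\<^bsup>-3/2\<^esup>\<close>. Taking square roots gives the last term of either bound, the
  constants being \<open>2.12\<^sup>2 \<ge> s(3)\<close> and \<open>2.27\<^sup>2 \<ge> s(4)\<close>. The leading terms \<open>\<alpha>\<close> and
  \<open>sqrt 3 \<alpha>\<^bsup>3/2\<^esup>\<close> come from \<open>r = 2\<close> and \<open>r = 3\<close>, where \<open>T(K)\<close> is computed explicitly.

  On the measure side, every signed measure in sight is a finite real combination of the laws of
  \<open>(X\<^bsub>f(1)\<^esub>,\<dots>,X\<^bsub>f(n)\<^esub>)\<close> with \<open>f : {1..n} \<rightarrow> {1..N}\<close>, and \<open>signed_integral_eq_sum\<close> shows that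
  integration is linear in such combinations.
\<close>

section \<open>A positive quadrature rule at the roots of minus one\<close>

definition neg_root :: "nat \<Rightarrow> nat \<Rightarrow> complex" where
  "neg_root r k = cis (pi * (2 * real k + 1) / real r)"

lemma norm_neg_root [simp]: "norm (neg_root r k) = 1"
  by (simp add: neg_root_def)

lemma neg_root_power:
  assumes "r > 0" shows "neg_root r k ^ r = -1"
proof -
  have "neg_root r k ^ r = cis (real r * (pi * (2 * real k + 1) / real r))"
    unfolding neg_root_def by (rule Complex.DeMoivre)
  also have "real r * (pi * (2 * real k + 1) / real r) = pi + 2 * pi * real k"
    using assms by (simp add: field_simps)
  also have "cis \<dots> = -1" by (simp flip: cis_mult)
  finally show ?thesis .
qed

text \<open>
  For \<open>|w| = 1\<close> conjugation inverts \<open>w\<close>, so this is the vanishing of the sum of the powers of a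
  nontrivial \<open>r\<close>-th root of unity.
\<close>

lemma neg_root_orthogonal:
  assumes "j < r" "a < r"
  shows "(\<Sum>k<r. neg_root r k ^ j * cnj (neg_root r k ^ a)) = (if j = a then of_nat r else 0)"
proof -
  define d where "d = real j - real a"
  define x where "x = cis (2 * pi * d / real r)"
  have r: "real r > 0" using assms by simp
  have tm: "neg_root r k ^ j * cnj (neg_root r k ^ a) = cis (pi * d / real r) * x ^ k" for k
  proof -
    have "neg_root r k ^ j * cnj (neg_root r k ^ a) = cis (real j * (pi * (2 * real k + 1) / real r) + real a * - (pi * (2 * real k + 1) / real r))"
      by (simp only: neg_root_def complex_cnj_power cis_cnj Complex.DeMoivre cis_mult mult_minus_right)
    also have "real j * (pi * (2 * real k + 1) / real r) + real a * - (pi * (2 * real k + 1) / real r)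
       = pi * d / real r + real k * (2 * pi * d / real r)"
      using r by (simp add: d_def field_simps)
    finally show ?thesis unfolding x_def Complex.DeMoivre cis_mult .
  qed
  show ?thesis
  proof (cases "j = a")
    case True
    then show ?thesis unfolding tm by (simp add: d_def x_def)
  next
    case False
    have "x \<noteq> 1"
    proof
      assume "x = 1"
      then have "cis (2 * pi * real j / real r) = cis (2 * pi * real a / real r)"
        unfolding x_def d_def
        by (simp add: diff_divide_distrib right_diff_distrib flip: cis_divide)
      then show False
        using Complex.bij_betw_roots_unity[of r] assms False by (auto simp: bij_betw_def inj_on_def)
    qed
    moreover have "x ^ r = 1"
    proof -
      have "x ^ r = cis (2 * pi * real j) / cis (2 * pi * real a)"
      proof -
        have "real r * (2 * pi * d / real r) = 2 * pi * real j - 2 * pi * real a"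
          using r by (simp add: d_def field_simps)
        then show ?thesis unfolding x_def Complex.DeMoivre by (simp only: cis_divide)
      qed
      then show ?thesis by simp
    qed
    ultimately have "(\<Sum>k<r. x ^ k) = 0" by (simp add: sum_gp_strict)
    then show ?thesis using False unfolding tm by (simp flip: sum_distrib_left)
  qed
qed

text \<open>
  The Fejer kernel, the squared modulus of the geometric sum \<open>1 + w + \<dots> + w\<^bsup>r-1\<^esup>\<close>. Its
  nonnegativity is what makes the quadrature rule below a convex combination.
\<close>

definition fejer_weight :: "nat \<Rightarrow> nat \<Rightarrow> real" where
  "fejer_weight r k = (cmod (\<Sum>a<r. neg_root r k ^ a))\<^sup>2"

text \<open>
  Two consecutive moments differ by \<open>2 r\<close>: the factor \<open>1 - w\<close> turns the geometric sum into
  \<open>1 - w\<^sup>r = 2\<close>, after which orthogonality evaluates the sum.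
\<close>

lemma fejer_weight_moment:
  assumes "j \<le> r"
  shows "(\<Sum>k<r. of_real (fejer_weight r k) * neg_root r k ^ j)
           = of_nat r * (of_nat r - 2 * of_nat j)"
proof (cases "r = 0")
  case True then show ?thesis by simp
next
  case False
  define D where "D k = (\<Sum>a<r. neg_root r k ^ a)" for k
  have w: "of_real (fejer_weight r k) = D k * cnj (D k)" for k
    unfolding fejer_weight_def D_def by (simp only: complex_norm_square)
  have orth: "(\<Sum>k<r. neg_root r k ^ i * cnj (D k)) = of_nat r" if "i < r" for i
  proof -
    have "(\<Sum>k<r. neg_root r k ^ i * cnj (D k))
        = (\<Sum>a<r. \<Sum>k<r. neg_root r k ^ i * cnj (neg_root r k ^ a))"
      unfolding D_def cnj_sum sum_distrib_left by (rule sum.swap)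
    also have "\<dots> = (\<Sum>a<r. if i = a then of_nat r else 0)"
      using that by (intro sum.cong refl neg_root_orthogonal) auto
    also have "\<dots> = of_nat r" using that by simp
    finally show ?thesis .
  qed
  show ?thesis using assms
  proof (induction j)
    case 0
    have "(\<Sum>k<r. of_real (fejer_weight r k) * neg_root r k ^ 0) = (\<Sum>i<r. \<Sum>k<r. neg_root r k ^ i * cnj (D k))"
      unfolding w by (subst sum.swap) (simp add: D_def sum_distrib_right)
    also have "\<dots> = of_nat r * of_nat r" by (simp add: orth)
    finally show ?case by simp
  next
    case (Suc j)
    have "(1 - neg_root r k) * D k = 2" for k
      using False by (simp add: D_def one_diff_power_eq[symmetric] neg_root_power)
    then have "of_real (fejer_weight r k) * neg_root r k ^ j * (1 - neg_root r k)
        = 2 * (neg_root r k ^ j * cnj (D k))" for k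
      unfolding w by (metis (no_types, lifting) mult.assoc mult.commute)
    then have "(\<Sum>k<r. of_real (fejer_weight r k) * neg_root r k ^ j * (1 - neg_root r k)) = 2 * of_nat r"
      using orth[of j] Suc.prems by (simp only: sum_distrib_left[symmetric] Suc_le_eq)
    then have "(\<Sum>k<r. of_real (fejer_weight r k) * neg_root r k ^ j)
      - (\<Sum>k<r. of_real (fejer_weight r k) * neg_root r k ^ Suc j) = 2 * of_nat r"
      by (simp add: algebra_simps sum_subtractf)
    then show ?case using Suc by (simp add: algebra_simps)
  qed
qed

lemma sum_fejer_weight: "(\<Sum>k<r. fejer_weight r k) = (real r)\<^sup>2"
proof -
  have "complex_of_real (\<Sum>k<r. fejer_weight r k) = of_real ((real r)\<^sup>2)"
    using fejer_weight_moment[of 0 r] by (simp add: power2_eq_square)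
  then show ?thesis by (simp only: of_real_eq_iff)
qed

section \<open>Symmetric multilinear forms on a complex Hilbert space\<close>

definition rms :: "'i set \<Rightarrow> ('i \<Rightarrow> complex) \<Rightarrow> real" where
  "rms A x = sqrt ((\<Sum>i\<in>A. (cmod (x i))\<^sup>2) / real (card A))"

lemma rms_nonneg [simp]: "rms A x \<ge> 0"
  by (simp add: rms_def sum_nonneg)

lemma rms_sq: "(rms A x)\<^sup>2 = (\<Sum>i\<in>A. (cmod (x i))\<^sup>2) / real (card A)"
  by (simp add: rms_def sum_nonneg)

lemma rms_scale: "rms A (\<lambda>i. c * x i) = cmod c * rms A x"
proof -
  have "(\<Sum>i\<in>A. (cmod (c * x i))\<^sup>2) / real (card A) = (cmod c)\<^sup>2 * ((\<Sum>i\<in>A. (cmod (x i))\<^sup>2) / real (card A))"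
    by (simp add: norm_mult power_mult_distrib sum_distrib_left)
  then show ?thesis unfolding rms_def by (simp only: real_sqrt_mult) simp
qed

text \<open>
  A form takes the list of its arguments, so that one and the same \<open>M\<close> covers all numbers of
  arguments and \<open>M (y # _)\<close> is again a symmetric form, with one argument fewer.
\<close>

locale symmetric_form =
  fixes M :: "('i \<Rightarrow> complex) list \<Rightarrow> complex"
  assumes lin: "\<And>a b x y zs. M ((\<lambda>i. a * x i + b * y i) # zs) = a * M (x # zs) + b * M (y # zs)"
    and sym: "\<And>xs ys. mset xs = mset ys \<Longrightarrow> M xs = M ys"
begin

lemma binomial_expansion:
  "M (replicate k (\<lambda>i. p i + w * q i) @ zs) =
     (\<Sum>j\<le>k. of_nat (k choose j) * w ^ j * M (replicate (k - j) p @ replicate j q @ zs))"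
proof (induction k arbitrary: zs)
  case 0 then show ?case by simp
next
  case (Suc k)
  let ?v = "\<lambda>i. p i + w * q i"
  let ?B = "\<lambda>j. M (replicate (Suc k - j) p @ replicate j q @ zs)"
  have "M (replicate (Suc k) ?v @ zs) = M (p # replicate k ?v @ zs) + w * M (q # replicate k ?v @ zs)"
    using lin[of 1 p w q "replicate k ?v @ zs"] by simp
  also have "M (p # replicate k ?v @ zs) = M (replicate k ?v @ p # zs)"
    by (rule sym) simp
  also have "M (q # replicate k ?v @ zs) = M (replicate k ?v @ q # zs)"
    by (rule sym) simp
  also have "M (replicate k ?v @ p # zs) = (\<Sum>j\<le>k. of_nat (k choose j) * w ^ j * ?B j)"
    unfolding Suc.IH
  proof (rule sum.cong[OF refl])
    fix j assume "j \<in> {..k}"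
    then have "M (replicate (k - j) p @ replicate j q @ p # zs) = ?B j"
      by (intro sym) (simp add: Suc_diff_le)
    then show "of_nat (k choose j) * w ^ j * M (replicate (k - j) p @ replicate j q @ p # zs) = of_nat (k choose j) * w ^ j * ?B j" by simp
  qed
  also have "M (replicate k ?v @ q # zs) = (\<Sum>j\<le>k. of_nat (k choose j) * w ^ j * ?B (Suc j))"
    unfolding Suc.IH
  proof (rule sum.cong[OF refl])
    fix j assume "j \<in> {..k}"
    then have "M (replicate (k - j) p @ replicate j q @ q # zs) = ?B (Suc j)"
      by (intro sym) simp
    then show "of_nat (k choose j) * w ^ j * M (replicate (k - j) p @ replicate j q @ q # zs) = of_nat (k choose j) * w ^ j * ?B (Suc j)" by simp
  qed
  also have "(\<Sum>j\<le>k. of_nat (k choose j) * w ^ j * ?B j) + w * (\<Sum>j\<le>k. of_nat (k choose j) * w ^ j * ?B (Suc j))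
     = (\<Sum>j\<le>Suc k. of_nat (Suc k choose j) * w ^ j * ?B j)"
  proof -
    have "(\<Sum>j\<le>k. of_nat (k choose j) * w ^ j * ?B j) = (\<Sum>j\<le>Suc k. of_nat (k choose j) * w ^ j * ?B j)"
      by simp
    also have "\<dots> = ?B 0 + (\<Sum>j\<le>k. of_nat (k choose Suc j) * w ^ Suc j * ?B (Suc j))"
      by (subst sum.atMost_Suc_shift) simp
    finally show ?thesis
      by (simp add: sum.atMost_Suc_shift sum_distrib_left sum.distrib algebra_simps del: sum.atMost_Suc)
  qed
  finally show ?case .
qed

text \<open>
  Expand the right-hand side in powers of the root. By the moments of the weights, the mixed
  term with \<open>j\<close> arguments \<open>q\<close> gets the factor \<open>r (r - 2 j)\<close>. The same factor appears in the
  expansion of the left-hand side, because \<open>r - 2 j = (r - j) - j\<close> and \<open>r - j\<close> and \<open>j\<close> are absorbed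
  into binomial coefficients with upper index \<open>r - 1\<close>.
\<close>

lemma polarization_identity:
  assumes "r > 0"
  shows "of_nat (r * r) * M ((\<lambda>i. p i - q i) # replicate (r - 1) (\<lambda>i. p i + q i)) =
     (\<Sum>k<r. of_real (fejer_weight r k) * M (replicate r (\<lambda>i. p i + neg_root r k * q i)))"
proof -
  obtain s where r: "r = Suc s" using assms gr0_implies_Suc by blast
  let ?B = "\<lambda>j. M (replicate (r - j) p @ replicate j q)"
  have "(\<Sum>k<r. of_real (fejer_weight r k) * M (replicate r (\<lambda>i. p i + neg_root r k * q i)))
    = (\<Sum>k<r. \<Sum>j\<le>r. of_real (fejer_weight r k) * (of_nat (r choose j) * neg_root r k ^ j * ?B j))"
    using binomial_expansion[of r p _ q "[]"] by (simp add: sum_distrib_left)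
  also have "\<dots> = (\<Sum>j\<le>r. \<Sum>k<r. of_real (fejer_weight r k) * (of_nat (r choose j) * neg_root r k ^ j * ?B j))"
    by (rule sum.swap)
  also have "\<dots> = (\<Sum>j\<le>r. of_nat (r choose j) * ?B j * (\<Sum>k<r. of_real (fejer_weight r k) * neg_root r k ^ j))"
    by (simp add: sum_distrib_left mult_ac)
  also have "\<dots> = of_nat r * (\<Sum>j\<le>r. of_nat (r choose j) * (of_nat r - 2 * of_nat j) * ?B j)"
    by (simp add: fejer_weight_moment sum_distrib_left mult_ac)
  also have "(\<Sum>j\<le>r. of_nat (r choose j) * (of_nat r - 2 * of_nat j) * ?B j)
     = (\<Sum>j\<le>r. of_nat ((r - j) * (r choose j)) * ?B j) - (\<Sum>j\<le>r. of_nat (j * (r choose j)) * ?B j)"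
    by (subst sum_subtractf[symmetric], rule sum.cong) (auto simp: of_nat_diff algebra_simps)
  also have "(\<Sum>j\<le>r. of_nat ((r - j) * (r choose j)) * ?B j) = (\<Sum>j\<le>s. of_nat (r * (s choose j)) * ?B j)"
  proof -
    have "(r - j) * (r choose j) = r * (s choose j)" if "j \<le> s" for j
      unfolding r using binomial_absorb_comp[of "Suc s" j] by simp
    then have "(\<Sum>j\<le>s. of_nat ((r - j) * (r choose j)) * ?B j) = (\<Sum>j\<le>s. of_nat (r * (s choose j)) * ?B j)"
      by (intro sum.cong refl) (simp only: atMost_iff)
    then show ?thesis by (simp add: r)
  qed
  also have "(\<Sum>j\<le>r. of_nat (j * (r choose j)) * ?B j) = (\<Sum>j\<le>s. of_nat (r * (s choose j)) * ?B (Suc j))"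
  proof -
    have "Suc j * (r choose Suc j) = r * (s choose j)" for j
      unfolding r by (simp only: Suc_times_binomial)
    then have "(\<Sum>j\<le>s. of_nat (Suc j * (r choose Suc j)) * ?B (Suc j)) = (\<Sum>j\<le>s. of_nat (r * (s choose j)) * ?B (Suc j))"
      by (simp only:)
    moreover have "(\<Sum>j\<le>r. of_nat (j * (r choose j)) * ?B j) = (\<Sum>j\<le>s. of_nat (Suc j * (r choose Suc j)) * ?B (Suc j))"
      unfolding r by (subst sum.atMost_Suc_shift) simp
    ultimately show ?thesis by simp
  qed
  also have "(\<Sum>j\<le>s. of_nat (r * (s choose j)) * ?B j) - (\<Sum>j\<le>s. of_nat (r * (s choose j)) * ?B (Suc j))
     = of_nat r * M ((\<lambda>i. p i - q i) # replicate s (\<lambda>i. p i + q i))"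
  proof -
    have a: "M (p # replicate s (\<lambda>i. p i + q i)) = (\<Sum>j\<le>s. of_nat (s choose j) * ?B j)"
    proof -
      have "M (p # replicate s (\<lambda>i. p i + q i)) = M (replicate s (\<lambda>i. p i + 1 * q i) @ [p])"
        by (rule sym) simp
      also have "\<dots> = (\<Sum>j\<le>s. of_nat (s choose j) * ?B j)"
        unfolding binomial_expansion by (intro sum.cong refl arg_cong2[where f="(*)"] sym) (simp_all add: r Suc_diff_le)
      finally show ?thesis .
    qed
    have b: "M (q # replicate s (\<lambda>i. p i + q i)) = (\<Sum>j\<le>s. of_nat (s choose j) * ?B (Suc j))"
    proof -
      have "M (q # replicate s (\<lambda>i. p i + q i)) = M (replicate s (\<lambda>i. p i + 1 * q i) @ [q])"
        by (rule sym) simp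
      also have "\<dots> = (\<Sum>j\<le>s. of_nat (s choose j) * ?B (Suc j))"
        unfolding binomial_expansion by (intro sum.cong refl arg_cong2[where f="(*)"] sym) (simp_all add: r)
      finally show ?thesis .
    qed
    have "M ((\<lambda>i. p i - q i) # replicate s (\<lambda>i. p i + q i))
       = M (p # replicate s (\<lambda>i. p i + q i)) - M (q # replicate s (\<lambda>i. p i + q i))"
      using lin[of 1 p "-1" q] by simp
    then show ?thesis unfolding a b
      by (simp only: sum_distrib_left right_diff_distrib of_nat_mult mult.assoc)
  qed
  finally show ?thesis by (simp only: r diff_Suc_1 of_nat_mult mult.assoc)
qed

end


text \<open>
  When \<open>\<langle>x, y\<rangle>\<close> is real, \<open>(x + y)/2\<close> and \<open>(x - y)/2\<close> are orthogonal with squared norms adding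
  up to 1. So all the vectors at which the polarization identity evaluates the form are unit
  vectors.
\<close>

lemma rms_rotate:
  assumes "Im (\<Sum>i\<in>A. x i * cnj (y i)) = 0" "rms A x = 1" "rms A y = 1" "cmod w = 1"
  shows "rms A (\<lambda>i. (x i + y i) / 2 + w * ((x i - y i) / 2)) = 1"
proof -
  have pt: "(cmod ((a + b) / 2 + w * ((a - b) / 2)))\<^sup>2
     = ((cmod a)\<^sup>2 + (cmod b)\<^sup>2) / 2 + Re (cnj w * (a * cnj a - b * cnj b - a * cnj b + cnj (a * cnj b))) / 2" for a b
  proof -
    have "complex_of_real ((cmod ((a + b) / 2 + w * ((a - b) / 2)))\<^sup>2) =
       ((a * cnj a + b * cnj b + 2 * Re (a * cnj b)) + (w * cnj w) * (a * cnj a + b * cnj b - 2 * Re (a * cnj b))) / 4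
        + Re (cnj w * (a * cnj a - b * cnj b - a * cnj b + cnj (a * cnj b))) / 2"
      unfolding complex_norm_square
      by (simp add: complex_eq_iff field_simps)
    also have "w * cnj w = 1"
      using assms(4) by (simp flip: complex_norm_square)
    finally have "complex_of_real ((cmod ((a + b) / 2 + w * ((a - b) / 2)))\<^sup>2) = complex_of_real (
       ((cmod a)\<^sup>2 + (cmod b)\<^sup>2) / 2 + Re (cnj w * (a * cnj a - b * cnj b - a * cnj b + cnj (a * cnj b))) / 2)"
      by (simp flip: complex_norm_square)
    then show ?thesis by (simp only: of_real_eq_iff)
  qed
  define S where "S = (\<Sum>i\<in>A. x i * cnj (y i))"
  have N: "(\<Sum>i\<in>A. (cmod (x i))\<^sup>2) = card A" "(\<Sum>i\<in>A. (cmod (y i))\<^sup>2) = card A" "card A \<noteq> 0"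
    using assms(2,3) by (auto simp: rms_def divide_eq_1_iff split: if_splits)
  have N': "(\<Sum>i\<in>A. x i * cnj (x i)) = card A" "(\<Sum>i\<in>A. y i * cnj (y i)) = card A"
    by (simp_all only: complex_norm_square[symmetric] of_real_sum[symmetric] N) simp_all
  have "(\<Sum>i\<in>A. (cmod ((x i + y i) / 2 + w * ((x i - y i) / 2)))\<^sup>2)
     = ((\<Sum>i\<in>A. (cmod (x i))\<^sup>2) + (\<Sum>i\<in>A. (cmod (y i))\<^sup>2)) / 2
     + Re (cnj w * ((\<Sum>i\<in>A. x i * cnj (x i)) - (\<Sum>i\<in>A. y i * cnj (y i)) - S + cnj S)) / 2"
    unfolding pt S_def
    by (simp only: sum_divide_distrib[symmetric] Re_sum[symmetric] sum_distrib_left[symmetric]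
        sum.distrib sum_subtractf cnj_sum)
  also have "\<dots> = card A"
    unfolding N N' using assms(1) by (simp add: S_def[symmetric])
  finally show ?thesis using N(3) by (simp add: rms_def)
qed

lemma (in symmetric_form) scale_replicate: "M (replicate k (\<lambda>i. c * x i) @ zs) = c ^ k * M (replicate k x @ zs)"
proof (induction k arbitrary: zs)
  case (Suc k)
  have "M ((\<lambda>i. c * x i) # replicate k (\<lambda>i. c * x i) @ zs) = c * M (x # replicate k (\<lambda>i. c * x i) @ zs)"
    using lin[of c x 0 x] by simp
  also have "M (x # replicate k (\<lambda>i. c * x i) @ zs) = M (replicate k (\<lambda>i. c * x i) @ x # zs)"
    by (rule sym) simp
  also have "\<dots> = c ^ k * M (replicate k x @ x # zs)" by (rule Suc.IH)
  also have "M (replicate k x @ x # zs) = M (replicate (Suc k) x @ zs)"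
    by (rule sym) simp
  finally show ?case by simp
qed simp

text \<open>
  The polarization identity with \<open>p = (x + y)/2\<close> and \<open>q = (x - y)/2\<close> exhibits the value at
  \<open>(y, x, \<dots>, x)\<close> as a convex combination of values on the diagonal at unit vectors.
\<close>

lemma (in symmetric_form) unit_bound:
  assumes V: "\<And>a b x y. x \<in> V \<Longrightarrow> y \<in> V \<Longrightarrow> (\<lambda>i. a * x i + b * y i) \<in> V"
    and diag: "\<And>x. x \<in> V \<Longrightarrow> norm (M (replicate r x)) \<le> C * rms A x ^ r"
    and xy: "x \<in> V" "y \<in> V" "rms A x = 1" "rms A y = 1" "Im (\<Sum>i\<in>A. x i * cnj (y i)) = 0"
    and r: "r > 0"
  shows "norm (M (y # replicate (r - 1) x)) \<le> C"
proof -
  let ?p = "\<lambda>i. (x i + y i) / 2" and ?q = "\<lambda>i. (x i - y i) / 2"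
  have V': "(\<lambda>i. ?p i + w * ?q i) \<in> V" for w
  proof -
    have "(\<lambda>i. ?p i + w * ?q i) = (\<lambda>i. ((1 + w) / 2) * x i + ((1 - w) / 2) * y i)"
      by (simp add: fun_eq_iff field_simps)
    then show ?thesis using V[OF xy(1,2)] by presburger
  qed
  have "of_nat (r * r) * M (y # replicate (r - 1) x) =
      of_nat (r * r) * M ((\<lambda>i. ?p i - ?q i) # replicate (r - 1) (\<lambda>i. ?p i + ?q i))"
    by (simp add: field_simps)
  also have "\<dots> = (\<Sum>k<r. of_real (fejer_weight r k) * M (replicate r (\<lambda>i. ?p i + neg_root r k * ?q i)))"
    by (rule polarization_identity[OF r])
  finally have "norm (of_nat (r * r) * M (y # replicate (r - 1) x)) \<le> (\<Sum>k<r. fejer_weight r k * C)"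
  proof (simp only:, intro sum_norm_le)
    fix k
    have "norm (M (replicate r (\<lambda>i. ?p i + neg_root r k * ?q i))) \<le> C"
      using diag[OF V', of "neg_root r k"] rms_rotate[OF xy(5,3,4), of "neg_root r k"] by simp
    then show "norm (of_real (fejer_weight r k) * M (replicate r (\<lambda>i. ?p i + neg_root r k * ?q i))) \<le> fejer_weight r k * C"
      
      unfolding norm_mult norm_of_real by (simp add: fejer_weight_def mult_left_mono)
  qed
  also have "\<dots> = (real r)\<^sup>2 * C" by (simp flip: sum_distrib_right add: sum_fejer_weight)
  finally show ?thesis using r by (simp add: norm_mult power2_eq_square)
qed

text \<open>
  Reduction to unit vectors with real inner product: rescale \<open>x\<close> and \<open>y\<close>, and multiply \<open>y\<close> by a
  phase \<open>u\<close>.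
\<close>

lemma (in symmetric_form) one_slot_bound:
  assumes V: "\<And>a b x y. x \<in> V \<Longrightarrow> y \<in> V \<Longrightarrow> (\<lambda>i. a * x i + b * y i) \<in> V"
    and null: "\<And>x zs. rms A x = 0 \<Longrightarrow> M (x # zs) = 0"
    and diag: "\<And>x. x \<in> V \<Longrightarrow> norm (M (replicate (Suc r) x)) \<le> C * rms A x ^ Suc r"
    and xy: "x \<in> V" "y \<in> V"
  shows "norm (M (y # replicate r x)) \<le> C * rms A y * rms A x ^ r"
proof (cases "rms A y = 0 \<or> r = 0 \<or> rms A x = 0")
  case True
  then consider "rms A y = 0" | "r = 0" | s where "rms A x = 0" "r = Suc s"
    using not0_implies_Suc by blast
  then show ?thesis
  proof cases
    case 1 then show ?thesis using null by simp
  next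
    case 2 then show ?thesis using diag[OF xy(2)] by simp
  next
    case 3
    have "M (y # replicate r x) = M (x # y # replicate s x)"
      using 3 by (intro sym) simp
    then show ?thesis using null 3 by simp
  qed
next
  case False
  then have pos: "rms A x > 0" "rms A y > 0" using rms_nonneg less_eq_real_def by auto
  define S where "S = (\<Sum>i\<in>A. x i * cnj (y i))"
  define u where "u = (if S = 0 then 1 else sgn S)"
  have u: "cmod u = 1" by (simp add: u_def norm_sgn)
  define x' where "x' = (\<lambda>i. (1 / of_real (rms A x)) * x i)"
  define y' where "y' = (\<lambda>i. (u / of_real (rms A y)) * y i)"
  have "(\<Sum>i\<in>A. x' i * cnj (y' i)) = (1 / of_real (rms A x * rms A y)) * (cnj u * S)"
    unfolding x'_def y'_def S_def sum_distrib_left by (intro sum.cong refl) (simp add: field_simps)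
  also have "cnj u * S = of_real (cmod S)"
    by (auto simp: u_def sgn_eq complex_norm_square[symmetric] power2_eq_square
       mult.commute[of "cnj S"])
  finally have "(\<Sum>i\<in>A. x' i * cnj (y' i)) = of_real (cmod S / (rms A x * rms A y))" by simp
  then have im: "Im (\<Sum>i\<in>A. x' i * cnj (y' i)) = 0" by (simp only: Im_complex_of_real)
  have V1: "(\<lambda>i. c * z i) \<in> V" if "z \<in> V" for c z
    using V[OF that that, of c 0] by simp
  have nx: "rms A x' = 1" "rms A y' = 1"
    unfolding x'_def y'_def rms_scale using pos u by (simp_all add: norm_divide)
  have "norm (M (y' # replicate (Suc r - 1) x')) \<le> C"
    by (rule unit_bound[OF V diag _ _ nx im]) (simp_all only: x'_def y'_def V1 xy zero_less_Suc)
  then have b: "norm (M (y' # replicate r x')) \<le> C" by simp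
  have "M (y' # replicate r x') = (u / of_real (rms A y)) * M (y # replicate r x')"
    unfolding y'_def using lin[of "u / of_real (rms A y)" y 0 y] by simp
  also have "M (y # replicate r x') = M (replicate r x' @ [y])" by (rule sym) simp
  also have "\<dots> = (1 / of_real (rms A x)) ^ r * M (replicate r x @ [y])"
    unfolding x'_def by (rule scale_replicate)
  also have "M (replicate r x @ [y]) = M (y # replicate r x)" by (rule sym) simp
  finally have "norm (M (y # replicate r x)) / (rms A y * rms A x ^ r) \<le> C"
    using b u by (simp add: norm_mult norm_divide norm_power power_divide)
  then show ?thesis using pos by (simp add: pos_divide_le_eq mult_ac)
qed

text \<open>
  Banach's theorem, for forms on a subspace \<open>V\<close>: moving one argument off the diagonal does not
  increase the bound, and fixing that argument leaves a form with one argument fewer, to which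
  induction applies.
\<close>

theorem symmetric_form_bound:
  assumes "symmetric_form M"
    and V: "\<And>a b x y. x \<in> V \<Longrightarrow> y \<in> V \<Longrightarrow> (\<lambda>i. a * x i + b * y i) \<in> V"
    and null: "\<And>x zs. rms A x = 0 \<Longrightarrow> M (x # zs) = 0"
    and diag: "\<And>x. x \<in> V \<Longrightarrow> norm (M (replicate r x)) \<le> C * rms A x ^ r"
    and xs: "set xs \<subseteq> V" "length xs = r" and "V \<noteq> {}"
  shows "norm (M xs) \<le> C * prod_list (map (rms A) xs)"
  using assms
proof (induction r arbitrary: M C xs)
  case 0
  then show ?case by auto
next
  case (Suc r)
  interpret symmetric_form M by fact
  obtain y ys where xs: "xs = y # ys" using Suc.prems(6) by (cases xs) auto
  let ?M = "\<lambda>zs. M (y # zs)"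
  have swap: "M (y # z # zs) = M (z # y # zs)" for z zs
    by (rule sym) simp
  have "norm (?M ys) \<le> (C * rms A y) * prod_list (map (rms A) ys)"
  proof (rule Suc.IH)
    show "symmetric_form ?M"
      by unfold_locales (simp_all add: swap lin sym)
    show "(\<lambda>i. a * u i + b * v i) \<in> V" if "u \<in> V" "v \<in> V" for a b u v by (rule V[OF that])
    show "?M (x # zs) = 0" if "rms A x = 0" for x zs
      using Suc.prems(3)[OF that] swap by simp
    show "norm (?M (replicate r x)) \<le> C * rms A y * rms A x ^ r" if "x \<in> V" for x
      by (rule one_slot_bound[OF V Suc.prems(3,4) that]) (use Suc.prems(5) xs in auto)
    show "set ys \<subseteq> V" "length ys = r" using Suc.prems(5,6) xs by auto
    show "V \<noteq> {}" by fact
  qed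
  then show ?case by (simp add: xs mult_ac)
qed

section \<open>Permanents of rectangular arrays\<close>

text \<open>
  The permanent of the array whose columns are the listed functions on \<open>A\<close>: the sum of
  \<open>\<Prod>\<^sub>i y\<^sub>i(j\<^sub>i)\<close> over all tuples of distinct indices \<open>j\<^sub>i \<in> A\<close>.
\<close>

fun permanent :: "'i set \<Rightarrow> ('i \<Rightarrow> complex) list \<Rightarrow> complex" where
  "permanent A [] = 1"
| "permanent A (y # ys) = (\<Sum>j\<in>A. y j * permanent (A - {j}) ys)"

lemma permanent_swap:
  assumes "finite A"
  shows "permanent A (x # y # zs) = permanent A (y # x # zs)"
proof -
  have "permanent A (x # y # zs) = (\<Sum>i\<in>A. \<Sum>j\<in>A. if i = j then 0 else x i * y j * permanent (A - {i} - {j}) zs)" for x y :: "'a \<Rightarrow> complex"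
  proof (simp only: permanent.simps, rule sum.cong[OF refl])
    fix i assume "i \<in> A"
    show "x i * (\<Sum>j\<in>A - {i}. y j * permanent (A - {i} - {j}) zs)
       = (\<Sum>j\<in>A. if i = j then 0 else x i * y j * permanent (A - {i} - {j}) zs)"
      unfolding sum_distrib_left using assms
      by (intro sum.mono_neutral_cong_left) (auto simp: mult_ac)
  qed
  note * = this
  have c: "A - {i} - {j} = A - {j} - {i}" for i j by blast
  show ?thesis unfolding * by (subst sum.swap, intro sum.cong refl) (simp add: c mult_ac)
qed

lemma permanent_move:
  assumes "finite A"
  shows "permanent A (us @ x # vs) = permanent A (x # us @ vs)"
  using assms
proof (induction us arbitrary: A)
  case (Cons u us)
  have "permanent A ((u # us) @ x # vs) = permanent A (u # x # us @ vs)"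
    using Cons by simp
  then show ?case using permanent_swap[OF Cons.prems, of u x] by simp
qed simp

lemma permanent_mset:
  assumes "finite A" "mset xs = mset ys"
  shows "permanent A xs = permanent A ys"
  using assms
proof (induction xs arbitrary: A ys)
  case (Cons x xs)
  have "x \<in> set ys" using Cons.prems(2) by (metis list.set_intros(1) set_mset_mset)
  then obtain us vs where ys: "ys = us @ x # vs" by (meson split_list)
  have "permanent A ys = permanent A (x # us @ vs)"
    unfolding ys by (rule permanent_move[OF Cons.prems(1)])
  also have "\<dots> = permanent A (x # xs)"
    using Cons.IH[of _ "us @ vs"] Cons.prems by (simp add: ys)
  finally show ?case by simp
qed simp

lemma permanent_form:
  assumes "finite A"
  shows "symmetric_form (permanent A)"
proof
  fix a b :: complex and x y :: "'a \<Rightarrow> complex" and zs :: "('a \<Rightarrow> complex) list"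
  show "permanent A ((\<lambda>i. a * x i + b * y i) # zs) = a * permanent A (x # zs) + b * permanent A (y # zs)"
    by (simp add: algebra_simps sum.distrib sum_distrib_left)
qed (rule permanent_mset[OF assms])

lemma permanent_card_less:
  assumes "finite A" "card A < length ys"
  shows "permanent A ys = 0"
  using assms
proof (induction ys arbitrary: A)
  case (Cons y ys)
  have "permanent (A - {j}) ys = 0" if "j \<in> A" for j
    using Cons.prems that card_gt_0_iff[of A] by (intro Cons.IH) auto
  then show ?case by simp
qed simp

lemma permanent_null:
  assumes "finite A" "rms A x = 0" 
  shows "permanent A (x # zs) = 0"
proof -
  have "x j = 0" if "j \<in> A" for j
    using assms that by (auto simp: rms_def sum_nonneg_eq_0_iff)
  then show ?thesis by simp
qed

text \<open>
  Tuples over \<open>insert a A\<close> either avoid \<open>a\<close> or use it in exactly one of the \<open>r\<close> slots.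
\<close>

lemma permanent_insert:
  assumes "finite A" "a \<notin> A"
  shows "permanent (insert a A) (replicate r y) =
     permanent A (replicate r y) + of_nat r * y a * permanent A (replicate (r - 1) y)"
  using assms
proof (induction r arbitrary: A)
  case (Suc r)
  have d: "insert a A - {j} = insert a (A - {j})" if "j \<in> A" for j using that Suc.prems by auto
  have da: "insert a A - {a} = A" using Suc.prems by auto
  have "permanent (insert a A) (replicate (Suc r) y) =
      y a * permanent A (replicate r y) + (\<Sum>j\<in>A. y j * permanent (insert a (A - {j})) (replicate r y))"
    using Suc.prems by (simp add: d da cong: sum.cong)
  also have "(\<Sum>j\<in>A. y j * permanent (insert a (A - {j})) (replicate r y)) =
     (\<Sum>j\<in>A. y j * permanent (A - {j}) (replicate r y)) +
     of_nat r * y a * (\<Sum>j\<in>A. y j * permanent (A - {j}) (replicate (r - 1) y))"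
    using Suc by (simp add: sum.distrib sum_distrib_left algebra_simps)
  also have "of_nat r * y a * (\<Sum>j\<in>A. y j * permanent (A - {j}) (replicate (r - 1) y))
     = of_nat r * y a * permanent A (replicate r y)"
    by (cases r) simp_all
  finally show ?case by (simp add: algebra_simps)
qed simp

text \<open>
  For equal columns the permanent is \<open>r!\<close> times an elementary symmetric polynomial of the
  values of \<open>y\<close>.
\<close>

lemma prod_generating:
  assumes "finite A"
  shows "(\<Prod>j\<in>A. 1 + t * y j) = (\<Sum>r\<le>card A. permanent A (replicate r y) / fact r * t ^ r)"
  using assms
proof (induction A rule: finite_induct)
  case (insert a A)
  let ?c = "\<lambda>A r. permanent A (replicate r y) / fact r * t ^ r"
  have "(\<Prod>j\<in>insert a A. 1 + t * y j) = (1 + t * y a) * (\<Sum>r\<le>card A. ?c A r)"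
    using insert by simp
  also have "\<dots> = (\<Sum>r\<le>card A. ?c A r) + (\<Sum>r\<le>card A. t * y a * ?c A r)"
    by (simp only: distrib_right mult_1 sum_distrib_left sum.distrib)
  also have "(\<Sum>r\<le>card A. ?c A r) = (\<Sum>r\<le>Suc (card A). ?c A r)"
    using permanent_card_less[OF insert(1), of "replicate (Suc (card A)) y"] by simp
  also have "\<dots> = ?c A 0 + (\<Sum>r\<le>card A. ?c A (Suc r))"
    by (rule sum.atMost_Suc_shift)
  also have "\<dots> + (\<Sum>r\<le>card A. t * y a * ?c A r) = ?c A 0 + (\<Sum>r\<le>card A. ?c (insert a A) (Suc r))"
  proof -
    have "?c A (Suc r) + t * y a * ?c A r = ?c (insert a A) (Suc r)" for r
      unfolding permanent_insert[OF insert(1,2)]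
      by (simp add: add_divide_distrib distrib_right del: permanent.simps of_nat_Suc)
    then show ?thesis by (simp only: add.assoc sum.distrib[symmetric])
  qed
  also have "\<dots> = (\<Sum>r\<le>Suc (card A). ?c (insert a A) r)"
    by (subst sum.atMost_Suc_shift) simp
  finally show ?case using insert by simp
qed simp

text \<open>
  A Cauchy estimate: the coefficient is an average of the polynomial, times a unimodular
  factor, over more nodes than the degree.
\<close>

lemma coefficient_bound:
  assumes bd: "\<And>w. cmod w = 1 \<Longrightarrow> norm (\<Sum>j\<le>m. c j * w ^ j) \<le> B" and "r \<le> m"
  shows "norm (c r) \<le> B"
proof -
  let ?\<rho> = "neg_root (Suc m)"
  have "(\<Sum>k<Suc m. (\<Sum>j\<le>m. c j * ?\<rho> k ^ j) * cnj (?\<rho> k ^ r))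
     = (\<Sum>j\<le>m. c j * (\<Sum>k<Suc m. ?\<rho> k ^ j * cnj (?\<rho> k ^ r)))"
    unfolding sum_distrib_left sum_distrib_right by (subst sum.swap) (simp only: mult.assoc)
  also have "\<dots> = (\<Sum>j\<le>m. c j * (if j = r then of_nat (Suc m) else 0))"
    using assms(2) by (intro sum.cong refl arg_cong2[where f="(*)"] neg_root_orthogonal) auto
  also have "\<dots> = of_nat (Suc m) * c r"
    using assms(2) by (simp add: if_distrib cong: if_cong)
  finally have "real (Suc m) * norm (c r) = norm (\<Sum>k<Suc m. (\<Sum>j\<le>m. c j * ?\<rho> k ^ j) * cnj (?\<rho> k ^ r))"
    by (simp only: norm_mult norm_of_nat)
  also have "\<dots> \<le> (\<Sum>k<Suc m. B)"
    by (intro sum_norm_le) (simp add: norm_mult norm_power bd)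
  finally show ?thesis by (simp add: algebra_simps del: of_nat_Suc)
qed

lemma prod_AM_GM:
  fixes f :: "'a \<Rightarrow> real"
  assumes "finite A" "A \<noteq> {}" "\<And>i. i \<in> A \<Longrightarrow> f i \<ge> 0"
  shows "(\<Prod>i\<in>A. f i) \<le> ((\<Sum>i\<in>A. f i) / card A) ^ card A"
proof -
  have "(\<Prod>i\<in>A. f i) = ((\<Prod>i\<in>A. f i) powr (1 / card A)) powr card A"
    using assms by (simp add: powr_powr prod_nonneg)
  also have "\<dots> \<le> (\<Sum>i\<in>A. f i / card A) powr card A"
    by (intro powr_mono2 arith_geom_mean assms) auto
  also have "\<dots> = ((\<Sum>i\<in>A. f i) / card A) ^ card A"
    using assms by (subst powr_realpow') (auto simp: sum_divide_distrib intro!: sum_nonneg)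
  finally show ?thesis .
qed


text \<open>
  For \<open>0 < r < N\<close> this is the minimum over \<open>t > 0\<close> of \<open>(1 + t\<^sup>2)\<^bsup>N/2\<^esup> / t\<^sup>r\<close>, which bounds the \<open>r\<close>-th elementary symmetric
  polynomial of \<open>N\<close> numbers with sum 0 and mean square 1.
\<close>

definition esym_bound :: "nat \<Rightarrow> nat \<Rightarrow> real" where
  "esym_bound N r = sqrt (real N ^ N / (real (N - r) ^ (N - r) * real r ^ r))"

text \<open>
  Write \<open>v\<close> for the root mean square of \<open>y\<close>. On a circle \<open>|w| = t\<close> the mean of \<open>|1 + w y\<^sub>j|\<^sup>2\<close> is \<open>1 + t\<^sup>2 v\<^sup>2\<close>, because \<open>y\<close> sums to 0. Hence the
  inequality of means bounds \<open>\<Prod>\<^sub>j |1 + w y\<^sub>j|\<close> by \<open>(1 + t\<^sup>2 v\<^sup>2)\<^bsup>N/2\<^esup>\<close>, and the Cauchy estimate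
  extracts the coefficient.
\<close>

lemma permanent_diagonal_bound:
  assumes fin: "finite A" and zero: "(\<Sum>i\<in>A. y i) = 0" and r: "0 < r" "r < card A"
  shows "norm (permanent A (replicate r y)) \<le> fact r * esym_bound (card A) r * rms A y ^ r"
proof (cases "rms A y = 0")
  case True
  then have "permanent A (replicate r y) = 0"
    using permanent_null[OF fin] r by (cases r) auto
  then show ?thesis using True r by (simp add: zero_power)
next
  case False
  then have v: "rms A y > 0" using rms_nonneg less_eq_real_def by metis
  define N where "N = card A"
  have N: "real N > 0" "real (N - r) = real N - real r" "real N - real r > 0" "A \<noteq> {}"
    using r by (auto simp: N_def of_nat_diff)
  \<comment> \<open>The minimiser of \<open>(1 + t\<^sup>2 v\<^sup>2)\<^bsup>N/2\<^esup> / t\<^sup>r\<close>.\<close>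
  define t where "t = sqrt (real r / real (N - r)) / rms A y"
  have t: "t > 0" "t\<^sup>2 * (rms A y)\<^sup>2 = real r / real (N - r)"
    using v r N by (simp_all add: t_def power_divide)
  let ?c = "\<lambda>j. permanent A (replicate j y) / fact j * of_real t ^ j"
  have "norm (?c r) \<le> sqrt ((real N / real (N - r)) ^ N)"
  proof (rule coefficient_bound)
    show "r \<le> card A" using r by simp
    fix w :: complex assume w: "cmod w = 1"
    have "(cmod (\<Prod>j\<in>A. 1 + of_real t * w * y j))\<^sup>2 = (\<Prod>j\<in>A. (cmod (1 + of_real t * w * y j))\<^sup>2)"
      by (simp add: prod_norm[symmetric] prod_power_distrib)
    also have "\<dots> \<le> ((\<Sum>j\<in>A. (cmod (1 + of_real t * w * y j))\<^sup>2) / N) ^ N"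
      unfolding N_def by (rule prod_AM_GM) (use fin N in auto)
    also have "(\<Sum>j\<in>A. (cmod (1 + of_real t * w * y j))\<^sup>2)
        = (\<Sum>j\<in>A. 1 + 2 * Re (of_real t * w * y j) + t\<^sup>2 * (cmod (y j))\<^sup>2)"
    proof (rule sum.cong[OF refl])
      fix j
      have "(cmod (1 + of_real t * w * y j))\<^sup>2 = 1 + 2 * Re (of_real t * w * y j) + (cmod (of_real t * w * y j))\<^sup>2"
        unfolding cmod_power2 by (simp add: power2_eq_square algebra_simps)
      then show "(cmod (1 + of_real t * w * y j))\<^sup>2 = 1 + 2 * Re (of_real t * w * y j) + t\<^sup>2 * (cmod (y j))\<^sup>2"
        using w t(1) by (simp add: norm_mult power_mult_distrib)
    qed
    also have "\<dots> = real N + 2 * Re (of_real t * w * (\<Sum>j\<in>A. y j)) + t\<^sup>2 * (\<Sum>j\<in>A. (cmod (y j))\<^sup>2)"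
      by (simp only: sum.distrib sum_distrib_left Re_sum) (simp add: N_def)
    also have "\<dots> = real N * (real N / real (N - r))"
    proof -
      have "(\<Sum>j\<in>A. (cmod (y j))\<^sup>2) = real N * (rms A y)\<^sup>2"
        using N by (simp add: rms_sq N_def)
      then have "t\<^sup>2 * (\<Sum>j\<in>A. (cmod (y j))\<^sup>2) = real N * (real r / real (N - r))"
        using t(2) by (metis mult.left_commute)
      then show ?thesis unfolding zero using N by (simp add: field_simps)
    qed
    also have "real N * (real N / real (N - r)) / real N = real N / real (N - r)"
      using N by simp
    finally have "cmod (\<Prod>j\<in>A. 1 + of_real t * w * y j) \<le> sqrt ((real N / real (N - r)) ^ N)"
      by (rule real_le_rsqrt)
    moreover have "(\<Prod>j\<in>A. 1 + of_real t * w * y j) = (\<Sum>j\<le>card A. ?c j * w ^ j)"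
      unfolding prod_generating[OF fin] by (simp add: power_mult_distrib mult_ac)
    ultimately show "cmod (\<Sum>j\<le>card A. ?c j * w ^ j) \<le> sqrt ((real N / real (N - r)) ^ N)"
      by simp
  qed
  then have "norm (permanent A (replicate r y)) * t ^ r \<le> fact r * sqrt ((real N / real (N - r)) ^ N)"
    using t(1) by (simp add: norm_mult norm_divide norm_power field_simps)
  moreover have "t ^ r = sqrt ((real r / real (N - r)) ^ r) / rms A y ^ r"
    by (simp add: t_def power_divide power_mult_distrib real_sqrt_power real_sqrt_divide)
  moreover have "sqrt ((real N / real (N - r)) ^ N) = esym_bound N r * sqrt ((real r / real (N - r)) ^ r)"
  proof -
    have "(real N / real (N - r)) ^ N = (real N ^ N / (real (N - r) ^ (N - r) * real r ^ r)) * (real r / real (N - r)) ^ r"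
    proof -
      have "real (N - r) ^ N = real (N - r) ^ (N - r) * real (N - r) ^ r"
        using r by (simp add: N_def flip: power_add)
      then show ?thesis using r by (simp add: power_divide)
    qed
    then show ?thesis unfolding esym_bound_def real_sqrt_mult[symmetric] by presburger
  qed
  ultimately have "norm (permanent A (replicate r y)) * sqrt ((real r / real (N - r)) ^ r)
     \<le> fact r * esym_bound N r * rms A y ^ r * sqrt ((real r / real (N - r)) ^ r)"
    using v by (simp add: pos_divide_le_eq mult_ac)
  moreover have "sqrt ((real r / real (N - r)) ^ r) > 0" using r N by simp
  ultimately show ?thesis by (simp add: N_def)
qed

text \<open>
  Functions with sum 0 form a subspace, so the diagonal bound carries over to different columns.
\<close>

theorem permanent_bound:
  assumes fin: "finite A" and zero: "\<And>y. y \<in> set ys \<Longrightarrow> (\<Sum>i\<in>A. y i) = 0"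
    and r: "0 < length ys" "length ys < card A"
  shows "norm (permanent A ys) \<le>
     fact (length ys) * esym_bound (card A) (length ys) * prod_list (map (rms A) ys)"
proof (rule symmetric_form_bound[OF permanent_form[OF fin], where V = "{y. (\<Sum>i\<in>A. y i) = 0}"])
  fix a b :: complex and x y :: "'a \<Rightarrow> complex"
  assume "x \<in> {y. (\<Sum>i\<in>A. y i) = 0}" "y \<in> {y. (\<Sum>i\<in>A. y i) = 0}"
  then show "(\<lambda>i. a * x i + b * y i) \<in> {y. (\<Sum>i\<in>A. y i) = 0}"
    by (simp add: sum.distrib flip: sum_distrib_left)
next
  show "{y::'a \<Rightarrow> complex. (\<Sum>i\<in>A. y i) = 0} \<noteq> {}"
    by (auto intro: exI[of _ "\<lambda>_. 0"])
qed (use permanent_null[OF fin] permanent_diagonal_bound[OF fin _ r] zero in auto)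

lemma permanent_pair:
  assumes fin: "finite A" and zero: "(\<Sum>i\<in>A. a i) = 0" "(\<Sum>i\<in>A. b i) = 0"
  shows "permanent A [a, b] = - (\<Sum>i\<in>A. a i * b i)"
  using assms by (simp add: sum_diff1 sum_negf algebra_simps cong: sum.cong)

lemma permanent_triple:
  assumes fin: "finite A" and zero: "(\<Sum>i\<in>A. a i) = 0" "(\<Sum>i\<in>A. b i) = 0" "(\<Sum>i\<in>A. c i) = 0"
  shows "permanent A [a, b, c] = 2 * (\<Sum>i\<in>A. a i * b i * c i)"
proof -
  have "(\<Sum>j\<in>A - {i}. b j * (\<Sum>k\<in>A - {i} - {j}. c k)) = 2 * (b i * c i) - (\<Sum>j\<in>A. b j * c j)"
    if "i \<in> A" for i
  proof -
    have "(\<Sum>k\<in>A - {i} - {j}. c k) = - c i - c j" if "j \<in> A - {i}" for j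
      using fin zero \<open>i \<in> A\<close> that by (simp add: sum_diff1)
    then have "(\<Sum>j\<in>A - {i}. b j * (\<Sum>k\<in>A - {i} - {j}. c k)) = (\<Sum>j\<in>A - {i}. b j * (- c i - c j))"
      by simp
    also have "\<dots> = (\<Sum>j\<in>A - {i}. b j) * (- c i) - (\<Sum>j\<in>A - {i}. b j * c j)"
      by (simp only: right_diff_distrib sum_subtractf sum_distrib_right)
    finally show ?thesis using fin zero that by (simp add: sum_diff1 algebra_simps)
  qed
  then have "permanent A [a, b, c] = (\<Sum>i\<in>A. a i * (2 * (b i * c i) - (\<Sum>j\<in>A. b j * c j)))"
    by simp
  also have "\<dots> = 2 * (\<Sum>i\<in>A. a i * b i * c i) - (\<Sum>i\<in>A. a i) * (\<Sum>j\<in>A. b j * c j)"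
    by (simp only: right_diff_distrib sum_subtractf sum_distrib_left[symmetric] sum_distrib_right[symmetric])
       (simp add: sum_distrib_left mult_ac)
  finally show ?thesis using zero by simp
qed

lemma sum_norm_mult_le_rms:
  assumes "finite A"
  shows "(\<Sum>i\<in>A. cmod (a i * b i)) \<le> card A * rms A a * rms A b"
proof (cases "A = {}")
  case False
  have L: "L2_set (\<lambda>i. cmod (x i)) A = sqrt (card A) * rms A x" for x :: "'a \<Rightarrow> complex"
    using assms False by (simp add: L2_set_def rms_def real_sqrt_divide)
  have "(\<Sum>i\<in>A. cmod (a i * b i)) \<le> L2_set (\<lambda>i. cmod (a i)) A * L2_set (\<lambda>i. cmod (b i)) A"
    using L2_set_mult_ineq[of "\<lambda>i. cmod (a i)" "\<lambda>i. cmod (b i)" A] by (simp add: norm_mult)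
  also have "\<dots> = (sqrt (card A) * sqrt (card A)) * rms A a * rms A b" by (simp only: L mult_ac)
  finally show ?thesis by simp
qed simp

lemma norm_le_rms:
  assumes "finite A" "i \<in> A"
  shows "cmod (a i) \<le> sqrt (card A) * rms A a"
proof -
  have "card A > 0" using assms card_gt_0_iff by blast
  have "(cmod (a i))\<^sup>2 \<le> (\<Sum>i\<in>A. (cmod (a i))\<^sup>2)"
    using assms by (intro member_le_sum) auto
  also have "\<dots> = (sqrt (card A) * rms A a)\<^sup>2"
    using \<open>card A > 0\<close> by (simp add: power_mult_distrib rms_sq)
  finally show ?thesis by (rule power2_le_imp_le) simp
qed

text \<open>
  The factor is the reciprocal of the number of tuples of distinct indices, if there are any.
\<close>

definition permanent_mean :: "'i set \<Rightarrow> ('i \<Rightarrow> complex) list \<Rightarrow> complex" where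
  "permanent_mean A ys = permanent A ys * fact (card A - length ys) / fact (card A)"

text \<open>
  A column of ones in the last slot only counts the indices that are still free.
\<close>

lemma permanent_one:
  assumes "finite A"
  shows "permanent A (ys @ [\<lambda>_. 1]) = of_nat (card A - length ys) * permanent A ys"
  using assms
proof (induction ys arbitrary: A)
  case (Cons y ys)
  have "permanent A ((y # ys) @ [\<lambda>_. 1]) = (\<Sum>j\<in>A. y j * (of_nat (card A - length (y # ys)) * permanent (A - {j}) ys))"
    using Cons by simp
  then show ?case by (simp add: sum_distrib_left mult_ac)
qed simp

lemma permanent_mean_ones:
  assumes "finite A" "length ys + c \<le> card A"
  shows "permanent_mean A (ys @ replicate c (\<lambda>_. 1)) = permanent_mean A ys"
  using assms(2)
proof (induction c)
  case (Suc c)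
  let ?us = "ys @ replicate c (\<lambda>_. 1)"
  have "permanent_mean A (ys @ replicate (Suc c) (\<lambda>_. 1)) = permanent_mean A (?us @ [\<lambda>_. 1])"
    by (simp add: replicate_append_same)
  also have "\<dots> = permanent_mean A ?us"
  proof -
    have "card A - length ?us = Suc (card A - length (?us @ [\<lambda>_. 1]))"
      using Suc.prems by simp
    then have "(fact (card A - length ?us) :: complex)
        = of_nat (card A - length ?us) * fact (card A - length (?us @ [\<lambda>_. 1]))"
      by (metis fact_Suc)
    then show ?thesis
      unfolding permanent_mean_def permanent_one[OF assms(1)] by (simp only: mult_ac)
  qed
  finally show ?case using Suc by simp
qed simp

lemma permanent_expand:
  assumes "distinct ks"
  shows "permanent A (map (\<lambda>k i. m k + y k i) ks) =
     (\<Sum>K\<in>Pow (set ks). (\<Prod>k\<in>set ks - K. m k) *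
        permanent A (map (\<lambda>k. if k \<in> K then y k else (\<lambda>_. 1)) ks))"
  using assms
proof (induction ks arbitrary: A)
  case (Cons k ks)
  let ?F = "\<lambda>A K ks. permanent A (map (\<lambda>k. if k \<in> K then y k else (\<lambda>_. 1)) ks)"
  have k: "k \<notin> set ks" using Cons.prems by simp
  have split: "(\<Sum>K\<in>Pow (set (k # ks)). G K) = (\<Sum>K\<in>Pow (set ks). G K + G (insert k K))" for G :: "_ \<Rightarrow> complex"
  proof -
    have "(\<Sum>K\<in>Pow (set (k # ks)). G K) = (\<Sum>K\<in>Pow (set ks). G K) + (\<Sum>K\<in>insert k ` Pow (set ks). G K)"
      using k by (simp add: Pow_insert) (intro sum.union_disjoint, auto)
    also have "(\<Sum>K\<in>insert k ` Pow (set ks). G K) = (\<Sum>K\<in>Pow (set ks). G (insert k K))"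
      using k by (subst sum.reindex) (auto simp: inj_on_def)
    finally show ?thesis by (simp only: sum.distrib)
  qed
  have "permanent A (map (\<lambda>k i. m k + y k i) (k # ks))
     = (\<Sum>j\<in>A. (m k + y k j) * (\<Sum>K\<in>Pow (set ks). (\<Prod>k\<in>set ks - K. m k) * ?F (A - {j}) K ks))"
    using Cons by simp
  also have "\<dots> = (\<Sum>K\<in>Pow (set ks). \<Sum>j\<in>A. (m k + y k j) * ((\<Prod>k\<in>set ks - K. m k) * ?F (A - {j}) K ks))"
    unfolding sum_distrib_left by (rule sum.swap)
  also have "\<dots> = (\<Sum>K\<in>Pow (set ks). (\<Prod>k\<in>set (k # ks) - K. m k) * ?F A K (k # ks)
       + (\<Prod>l\<in>set (k # ks) - insert k K. m l) * ?F A (insert k K) (k # ks))"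
  proof (rule sum.cong[OF refl])
    fix K assume "K \<in> Pow (set ks)"
    then have K: "K \<subseteq> set ks" "k \<notin> K" using k by auto
    have 1: "(\<Prod>l\<in>set (k # ks) - K. m l) = m k * (\<Prod>l\<in>set ks - K. m l)"
    proof -
      have "set (k # ks) - K = insert k (set ks - K)" using K by auto
      then show ?thesis using k by simp
    qed
    have 2: "set (k # ks) - insert k K = set ks - K" using k by auto
    have 3: "map (\<lambda>l. if l \<in> insert k K then y l else (\<lambda>_. 1)) ks = map (\<lambda>l. if l \<in> K then y l else (\<lambda>_. 1)) ks"
      using k by auto
    have 4: "?F A K (k # ks) = (\<Sum>j\<in>A. ?F (A - {j}) K ks)" using K by simp
    have 5: "?F A (insert k K) (k # ks) = (\<Sum>j\<in>A. y k j * ?F (A - {j}) K ks)"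
      by (simp only: list.map permanent.simps 3 insertI1 if_True)
    show "(\<Sum>j\<in>A. (m k + y k j) * ((\<Prod>k\<in>set ks - K. m k) * ?F (A - {j}) K ks)) =
       (\<Prod>k\<in>set (k # ks) - K. m k) * ?F A K (k # ks)
       + (\<Prod>l\<in>set (k # ks) - insert k K. m l) * ?F A (insert k K) (k # ks)"
      unfolding 1 2 4 5 by (simp add: sum_distrib_left sum.distrib algebra_simps)
  qed
  also have "\<dots> = (\<Sum>K\<in>Pow (set (k # ks)). (\<Prod>k\<in>set (k # ks) - K. m k) * ?F A K (k # ks))"
    by (rule split[symmetric])
  finally show ?case .
qed simp

text \<open>
  Multilinearity. Columns of ones do not affect the average, so in the term of \<open>K\<close> only the
  columns \<open>y k\<close> with \<open>k \<in> K\<close> remain.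
\<close>

lemma permanent_mean_expand:
  assumes fin: "finite A" and ks: "distinct ks" "length ks \<le> card A"
  shows "permanent_mean A (map (\<lambda>k i. m k + y k i) ks) =
     (\<Sum>K\<in>Pow (set ks). (\<Prod>k\<in>set ks - K. m k) * permanent_mean A (map y (filter (\<lambda>k. k \<in> K) ks)))"
proof -
  have "permanent_mean A (map (\<lambda>k i. m k + y k i) ks) =
     (\<Sum>K\<in>Pow (set ks). (\<Prod>k\<in>set ks - K. m k) * permanent_mean A (map (\<lambda>k. if k \<in> K then y k else (\<lambda>_. 1)) ks))"
    unfolding permanent_mean_def permanent_expand[OF ks(1)]
    by (simp add: sum_distrib_right sum_divide_distrib mult.assoc)
  also have "\<dots> = (\<Sum>K\<in>Pow (set ks). (\<Prod>k\<in>set ks - K. m k) * permanent_mean A (map y (filter (\<lambda>k. k \<in> K) ks)))"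
  proof (intro sum.cong refl arg_cong2[where f="(*)"])
    fix K
    let ?l = "map (\<lambda>k. if k \<in> K then y k else (\<lambda>_. 1)) ks"
    let ?l' = "map y (filter (\<lambda>k. k \<in> K) ks) @ replicate (length (filter (\<lambda>k. k \<notin> K) ks)) (\<lambda>_. 1)"
    have len: "length (filter (\<lambda>k. k \<in> K) ks) + length (filter (\<lambda>k. k \<notin> K) ks) = length ks"
      by (rule sum_length_filter_compl)
    have "mset ?l = mset ?l'"
      by (induction ks) auto
    then have "permanent_mean A ?l = permanent_mean A ?l'"
      using permanent_mset[OF fin, of ?l ?l'] len by (simp add: permanent_mean_def)
    also have "\<dots> = permanent_mean A (map y (filter (\<lambda>k. k \<in> K) ks))"
      by (rule permanent_mean_ones[OF fin]) (use len ks in simp)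
    finally show "permanent_mean A ?l = permanent_mean A (map y (filter (\<lambda>k. k \<in> K) ks))" .
  qed
  finally show ?thesis .
qed

section \<open>Growth of the Stirling ratio\<close>

text \<open>
  By Stirling's formula this is asymptotic to \<open>sqrt (2 \<pi> m)\<close>; the convention \<open>0\<^sup>0 = 1\<close> gives it the
  value 1 at 0.
\<close>

definition stirling_ratio :: "nat \<Rightarrow> real" where
  "stirling_ratio m = fact m * exp (real m) / real m ^ m"

lemma stirling_ratio_pos: "stirling_ratio m > 0"
  by (cases m) (simp_all add: stirling_ratio_def)

lemma stirling_ratio_Suc:
  assumes "m > 0"
  shows "stirling_ratio (Suc m) = stirling_ratio m * (exp 1 / (1 + 1 / real m) ^ m)"
proof -
  have "1 + 1 / real m = real (Suc m) / real m" using assms by (simp add: field_simps)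
  moreover have "stirling_ratio (Suc m) = fact m * exp (real m) * exp 1 / real (Suc m) ^ m"
    by (simp add: stirling_ratio_def exp_add del: of_nat_Suc) (simp add: exp_add)
  ultimately show ?thesis
    using assms by (simp add: stirling_ratio_def power_divide del: of_nat_Suc)
qed

lemma stirling_ratio_mono: "m \<le> n \<Longrightarrow> stirling_ratio m \<le> stirling_ratio n"
proof (rule lift_Suc_mono_le[where f = stirling_ratio])
  fix m
  show "stirling_ratio m \<le> stirling_ratio (Suc m)"
  proof (cases "m = 0")
    case False
    have "(1 + 1 / real m) ^ m \<le> exp (1 / real m) ^ m"
      by (intro power_mono exp_ge_add_one_self) simp
    also have "\<dots> = exp 1" using False by (simp flip: exp_of_nat_mult)
    finally have "1 \<le> exp 1 / (1 + 1 / real m) ^ m"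
      using False by (simp add: add_pos_pos)
    then show ?thesis
      using stirling_ratio_pos[of m] False
      by (simp only: stirling_ratio_Suc mult_le_cancel_left1) simp
  qed (simp add: stirling_ratio_def)
qed

lemma ln_add_one_ge:
  fixes x :: real assumes "x \<ge> 0"
  shows "2 * x / (2 + x) \<le> ln (1 + x)"
proof -
  have "(\<lambda>x. ln (1 + x) - 2 * x / (2 + x)) 0 \<le> (\<lambda>x. ln (1 + x) - 2 * x / (2 + x)) x"
  proof (rule DERIV_nonneg_imp_nondecreasing[OF assms])
    fix t :: real assume t: "0 \<le> t"
    have "((\<lambda>x. ln (1 + x) - 2 * x / (2 + x)) has_real_derivative (1 / (1 + t) - 4 / (2 + t)\<^sup>2)) (at t)"
      using t by (auto intro!: derivative_eq_intros simp: power2_eq_square field_simps)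
    moreover have "1 / (1 + t) - 4 / (2 + t)\<^sup>2 = t\<^sup>2 / ((1 + t) * (2 + t)\<^sup>2)"
      using t by (simp add: power2_eq_square divide_simps) (simp add: algebra_simps)
    ultimately show "\<exists>y. ((\<lambda>x. ln (1 + x) - 2 * x / (2 + x)) has_real_derivative y) (at t) \<and> 0 \<le> y"
      using t by (intro exI[of _ "t\<^sup>2 / ((1 + t) * (2 + t)\<^sup>2)"]) auto
  qed
  then show ?thesis by simp
qed

text \<open>
  With \<open>ln (1 + x) \<ge> 2 x / (2 + x)\<close> applied to \<open>x = 1/m\<close> and to \<open>x = 1/(2 m)\<close>, the sum
  \<open>m ln (1 + 1/m) + ln (1 + 1/(2 m))\<close> is seen to be at least 1.
\<close>

lemma stirling_ratio_growth:
  assumes "m > 0"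
  shows "stirling_ratio (Suc m) \<le> stirling_ratio m * (1 + 1 / (2 * real m))"
proof -
  have m: "real m \<ge> 1" using assms by simp
  have "1 \<le> real m * (2 * (1 / real m) / (2 + 1 / real m)) + 2 * (1 / (2 * real m)) / (2 + 1 / (2 * real m))"
    using m by (simp add: divide_simps) (simp add: algebra_simps)
  also have "\<dots> \<le> real m * ln (1 + 1 / real m) + ln (1 + 1 / (2 * real m))"
    by (intro add_mono mult_left_mono ln_add_one_ge) auto
  finally have "exp 1 \<le> exp (real m * ln (1 + 1 / real m) + ln (1 + 1 / (2 * real m)))"
    by simp
  also have "\<dots> = (1 + 1 / real m) ^ m * (1 + 1 / (2 * real m))"
    using m by (simp add: exp_add exp_of_nat_mult add_pos_pos)
  finally have "exp 1 / (1 + 1 / real m) ^ m \<le> 1 + 1 / (2 * real m)"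
    using m by (simp add: divide_le_eq add_pos_pos mult.commute)
  then show ?thesis
    unfolding stirling_ratio_Suc[OF assms] using stirling_ratio_pos[of m]
    by (intro mult_left_mono) auto
qed

text \<open>
  The coefficients of the power series of \<open>(1 - x)\<^bsup>-3/2\<^esup>\<close>.
\<close>

definition neg_binom :: "nat \<Rightarrow> real" where
  "neg_binom k = (- 3 / 2 gchoose k) * (-1) ^ k"

lemma neg_binom_Suc: "neg_binom (Suc k) = neg_binom k * (1 + 1 / (2 * real (Suc k)))"
proof -
  have "real (Suc k) * (- 3 / 2 gchoose Suc k) = (- 3 / 2 - real k) * (- 3 / 2 gchoose k)"
    using gbinomial_mult_1[of "- 3 / 2 :: real" k] by (simp add: algebra_simps)
  then have *: "(- 3 / 2 gchoose Suc k) = (- 3 / 2 - real k) * (- 3 / 2 gchoose k) / real (Suc k)"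
    by (simp add: field_simps del: of_nat_Suc)
  have "- (- 3 / 2 - real k) / real (Suc k) = 1 + 1 / (2 * real (Suc k))"
    by (simp add: field_simps)
  moreover have "neg_binom (Suc k) = neg_binom k * (- (- 3 / 2 - real k) / real (Suc k))"
    unfolding neg_binom_def *
    by (simp only: power_Suc divide_inverse mult_minus_left mult_minus_right mult_1_left mult.commute mult.left_commute)
  ultimately show ?thesis by simp
qed

lemma neg_binom_0: "neg_binom 0 = 1" by (simp add: neg_binom_def)

lemma neg_binom_pos: "neg_binom k > 0"
  by (induction k) (simp_all add: neg_binom_0 neg_binom_Suc add_pos_pos)

lemma neg_binom_sums:
  assumes "0 \<le> (x::real)" "x < 1"
  shows "(\<lambda>k. neg_binom k * x ^ k) sums (1 - x) powr (- 3 / 2)"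
  using gen_binomial_real[of "- x" "- 3 / 2"] assms
  by (simp add: neg_binom_def power_minus[of x] mult_ac)

text \<open>
  From \<open>r0 + k\<close> to \<open>r0 + k + 1\<close> the Stirling ratio grows at most by the factor
  \<open>1 + 1/(2 (r0 + k))\<close>, while the binomial coefficient grows exactly by \<open>1 + 1/(2 (k + 1))\<close>. This is
  where the exponent \<open>-3/2\<close> comes from.
\<close>

lemma stirling_ratio_le_neg_binom:
  assumes "r0 > 0"
  shows "stirling_ratio (r0 + k) \<le> stirling_ratio r0 * neg_binom k"
proof (induction k)
  case 0 then show ?case by (simp add: neg_binom_0)
next
  case (Suc k)
  have "stirling_ratio (r0 + Suc k) \<le> stirling_ratio (r0 + k) * (1 + 1 / (2 * real (r0 + k)))"
    using stirling_ratio_growth[of "r0 + k"] assms by simp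
  also have "\<dots> \<le> stirling_ratio r0 * neg_binom k * (1 + 1 / (2 * real (Suc k)))"
    using Suc assms stirling_ratio_pos neg_binom_pos[of k]
    by (intro mult_mono add_left_mono divide_left_mono) (auto simp: less_imp_le)
  finally show ?case by (simp add: neg_binom_Suc mult_ac)
qed

lemma stirling_ratio_sum_le:
  assumes "r0 > 0" "0 \<le> (x::real)" "x < 1"
  shows "(\<Sum>r=r0..n. stirling_ratio r * x ^ r) \<le> stirling_ratio r0 * x ^ r0 * (1 - x) powr (- 3 / 2)"
proof -
  have "(\<Sum>r=r0..n. stirling_ratio r * x ^ r) \<le> (\<Sum>r=r0..r0 + n. stirling_ratio r * x ^ r)"
    using assms stirling_ratio_pos by (intro sum_mono2) (auto simp: less_imp_le)
  also have "\<dots> = (\<Sum>k\<le>n. stirling_ratio (r0 + k) * x ^ (r0 + k))"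
    using sum.shift_bounds_cl_nat_ivl[of "\<lambda>r. stirling_ratio r * x ^ r" 0 r0 n]
    by (simp add: atLeast0AtMost add.commute)
  also have "\<dots> \<le> (\<Sum>k\<le>n. (stirling_ratio r0 * neg_binom k) * x ^ (r0 + k))"
    using assms by (intro sum_mono mult_right_mono stirling_ratio_le_neg_binom) auto
  also have "\<dots> = stirling_ratio r0 * x ^ r0 * (\<Sum>k\<le>n. neg_binom k * x ^ k)"
    by (simp add: sum_distrib_left power_add mult_ac)
  also have "\<dots> \<le> stirling_ratio r0 * x ^ r0 * (1 - x) powr (- 3 / 2)"
  proof (rule mult_left_mono)
    have "(\<Sum>k\<le>n. neg_binom k * x ^ k) \<le> (\<Sum>k. neg_binom k * x ^ k)"
      using neg_binom_sums[OF assms(2,3)] neg_binom_pos assms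
      by (intro sum_le_suminf) (auto simp: sums_iff less_imp_le)
    then show "(\<Sum>k\<le>n. neg_binom k * x ^ k) \<le> (1 - x) powr (- 3 / 2)"
      using neg_binom_sums[OF assms(2,3)] by (simp add: sums_iff)
  qed (use assms stirling_ratio_pos[of r0] in \<open>auto simp: less_imp_le\<close>)
  finally show ?thesis .
qed

lemma stirling_ratio_3: "stirling_ratio 3 \<le> 2.12\<^sup>2"
proof -
  have "exp (3::real) = exp 1 ^ 3" by (simp flip: exp_of_nat_mult)
  also have "\<dots> \<le> (272 / 100) ^ 3" using e_less_272 by (intro power_mono) auto
  finally show ?thesis by (simp add: stirling_ratio_def fact_numeral power2_eq_square power_divide)
qed

lemma stirling_ratio_4: "stirling_ratio 4 \<le> 2.27\<^sup>2"
proof -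
  have "exp (4::real) = exp 1 ^ 4" by (simp flip: exp_of_nat_mult)
  also have "\<dots> \<le> (272 / 100) ^ 4" using e_less_272 by (intro power_mono) auto
  finally show ?thesis by (simp add: stirling_ratio_def fact_numeral power2_eq_square power_divide)
qed

lemma binomial_ratio_le:
  assumes "n \<le> N" "N > 0"
  shows "real (n choose r) / real (N choose r) \<le> (real n / real N) ^ r"
proof (induction r)
  case (Suc r)
  show ?case
  proof (cases "r < n")
    case False then show ?thesis using assms by (simp add: binomial_eq_0)
  next
    case True
    have a: "real (m choose Suc r) = real (m choose r) * ((real m - real r) / real (Suc r))" if "r < m" for m
    proof -
      have "Suc r * (m choose Suc r) = (m - r) * (m choose r)"
        using binomial_absorb_comp[of m r] binomial_absorption[of r m] by (simp add: mult.commute)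
      then have "real (Suc r) * real (m choose Suc r) = (real m - real r) * real (m choose r)"
        using that by (metis less_imp_le of_nat_diff of_nat_mult)
      then show ?thesis by (simp add: field_simps del: of_nat_Suc)
    qed
    have "real (n choose Suc r) / real (N choose Suc r)
        = real (n choose r) / real (N choose r) * ((real n - real r) / (real N - real r))"
      using True assms by (simp add: a del: of_nat_Suc)
    also have "\<dots> \<le> (real n / real N) ^ r * (real n / real N)"
    proof (intro mult_mono Suc.IH)
      show "(real n - real r) / (real N - real r) \<le> real n / real N"
        using True assms by (simp add: divide_simps algebra_simps mult_right_mono)
    qed (use True assms in auto)
    finally show ?thesis by (simp only: power_Suc2)
  qed
qed simp

section \<open>Approximation of the permanent of a bounded array\<close>

lemma esym_bound_nonneg [simp]: "esym_bound N r \<ge> 0" by (simp add: esym_bound_def)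

text \<open>
  \<open>(esym_bound N r)\<^sup>2 / (N choose r)\<close> is the reciprocal of the probability that a binomial variable
  with parameters \<open>N\<close> and \<open>r/N\<close> equals \<open>r\<close>. It equals \<open>s(r) s(N - r) / s(N)\<close> for the Stirling ratio
  \<open>s\<close>, and \<open>s(N - r) \<le> s(N)\<close>.
\<close>

lemma esym_bound_binomial_le:
  assumes "0 < r" "r \<le> n" "n < N"
  shows "real (n choose r) * (esym_bound N r / real (N choose r))\<^sup>2 \<le> stirling_ratio r * (real n / real N) ^ r"
proof -
  have C: "real (N choose r) = fact N / (fact r * fact (N - r))"
    using assms by (intro binomial_fact) auto
  have "(esym_bound N r)\<^sup>2 / real (N choose r) = stirling_ratio r * stirling_ratio (N - r) / stirling_ratio N"
  proof -
    have "exp (real N) = exp (real r) * exp (real (N - r))"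
      using assms by (simp flip: exp_add)
    then show ?thesis
      using assms unfolding C esym_bound_def stirling_ratio_def by (simp add: field_simps)
  qed
  also have "\<dots> \<le> stirling_ratio r"
    using stirling_ratio_mono[of "N - r" N] stirling_ratio_pos[of N] stirling_ratio_pos[of r]
    by (simp add: divide_le_eq)
  finally have 1: "(esym_bound N r)\<^sup>2 / real (N choose r) \<le> stirling_ratio r" .
  have "real (n choose r) * (esym_bound N r / real (N choose r))\<^sup>2
     = ((esym_bound N r)\<^sup>2 / real (N choose r)) * (real (n choose r) / real (N choose r))"
    by (simp add: power2_eq_square)
  also have "\<dots> \<le> stirling_ratio r * (real n / real N) ^ r"
    by (intro mult_mono 1 binomial_ratio_le) (use assms stirling_ratio_pos[of r] in auto)
  finally show ?thesis .
qed

text \<open>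
  Cauchy-Schwarz over the sets \<open>K\<close>. The products \<open>\<Prod>\<^sub>k\<^sub>\<in>\<^sub>K v\<^sub>k\<^sup>2 \<Prod>\<^sub>k\<^sub>\<notin>\<^sub>K |m\<^sub>k|\<^sup>2\<close>, summed over all
  subsets of \<open>I\<close>, give \<open>\<Prod>\<^sub>k (v\<^sub>k\<^sup>2 + |m\<^sub>k|\<^sup>2) \<le> 1\<close>.
\<close>

lemma subset_expansion_bound:
  fixes m :: "nat \<Rightarrow> complex" and T :: "nat set \<Rightarrow> complex"
  assumes "finite I" "\<K> \<subseteq> Pow I"
    and mv: "\<And>k. k \<in> I \<Longrightarrow> (cmod (m k))\<^sup>2 + (v k)\<^sup>2 \<le> 1" "\<And>k. v k \<ge> 0"
    and T: "\<And>K. K \<in> \<K> \<Longrightarrow> norm (T K) \<le> b (card K) * (\<Prod>k\<in>K. v k)"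
    and b: "\<And>r. b r \<ge> 0"
  shows "norm (\<Sum>K\<in>\<K>. (\<Prod>k\<in>I - K. m k) * T K) \<le> sqrt (\<Sum>K\<in>\<K>. (b (card K))\<^sup>2)"
proof -
  have fin: "finite \<K>" using assms finite_subset by blast
  let ?g = "\<lambda>K. (\<Prod>k\<in>K. v k) * (\<Prod>k\<in>I - K. cmod (m k))"
  have g0: "?g K \<ge> 0" for K using mv(2) by (intro mult_nonneg_nonneg prod_nonneg) auto
  have "norm (\<Sum>K\<in>\<K>. (\<Prod>k\<in>I - K. m k) * T K) \<le> (\<Sum>K\<in>\<K>. \<bar>b (card K)\<bar> * \<bar>?g K\<bar>)"
  proof (rule sum_norm_le)
    fix K assume "K \<in> \<K>"
    have "norm ((\<Prod>k\<in>I - K. m k) * T K) \<le> (\<Prod>k\<in>I - K. cmod (m k)) * (b (card K) * (\<Prod>k\<in>K. v k))"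
      unfolding norm_mult prod_norm[symmetric] by (intro mult_left_mono T \<open>K \<in> \<K>\<close> prod_nonneg) auto
    then show "norm ((\<Prod>k\<in>I - K. m k) * T K) \<le> \<bar>b (card K)\<bar> * \<bar>?g K\<bar>"
      using b[of "card K"] g0[of K] by (simp add: mult_ac)
  qed
  also have "\<dots> \<le> L2_set (\<lambda>K. b (card K)) \<K> * L2_set ?g \<K>"
    by (rule L2_set_mult_ineq)
  also have "\<dots> \<le> L2_set (\<lambda>K. b (card K)) \<K> * 1"
  proof (rule mult_left_mono)
    have "(\<Sum>K\<in>\<K>. (?g K)\<^sup>2) \<le> (\<Sum>K\<in>Pow I. (?g K)\<^sup>2)"
      by (rule sum_mono2) (use assms in auto)
    also have "\<dots> = (\<Prod>k\<in>I. (v k)\<^sup>2 + (cmod (m k))\<^sup>2)"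
      using assms by (simp add: prod_add power_mult_distrib prod_power_distrib)
    also have "\<dots> \<le> 1"
      using mv by (intro prod_le_1) (auto simp: add.commute)
    finally show "L2_set ?g \<K> \<le> 1" by (simp add: L2_set_def)
  qed (rule L2_set_nonneg)
  finally show ?thesis by (simp add: L2_set_def)
qed

lemma sum_subsets_card:
  fixes h :: "nat \<Rightarrow> real"
  assumes "finite I"
  shows "(\<Sum>K | K \<subseteq> I \<and> r0 \<le> card K. h (card K)) = (\<Sum>r=r0..card I. real (card I choose r) * h r)"
proof -
  have "{K. K \<subseteq> I \<and> r0 \<le> card K} = (\<Union>r\<in>{r0..card I}. {K. K \<subseteq> I \<and> card K = r})"
    using card_mono[OF assms] by auto
  then have "(\<Sum>K | K \<subseteq> I \<and> r0 \<le> card K. h (card K)) = (\<Sum>r=r0..card I. \<Sum>K | K \<subseteq> I \<and> card K = r. h (card K))"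
    using assms by (simp only:) (subst sum.UNION_disjoint, auto)
  also have "\<dots> = (\<Sum>r=r0..card I. real (card I choose r) * h r)"
  proof (rule sum.cong[OF refl])
    fix r
    have "(\<Sum>K | K \<subseteq> I \<and> card K = r. h (card K)) = (\<Sum>K | K \<subseteq> I \<and> card K = r. h r)"
      by (rule sum.cong) auto
    then show "(\<Sum>K | K \<subseteq> I \<and> card K = r. h (card K)) = real (card I choose r) * h r"
      by (simp add: n_subsets[OF assms])
  qed
  finally show ?thesis .
qed

text \<open>
  The deterministic situation for a fixed outcome: \<open>n\<close> columns of length \<open>N\<close> with entries in the
  unit disc, split into their means \<open>m\<close> and centred parts \<open>y\<close>.
\<close>

locale columns =
  fixes A :: "'i set" and z :: "nat \<Rightarrow> 'i \<Rightarrow> complex" and N n :: nat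
  assumes fin: "finite A" and card: "card A = N" and n: "1 \<le> n" "n < N"
    and z: "\<And>k i. k \<in> {1..n} \<Longrightarrow> i \<in> A \<Longrightarrow> cmod (z k i) \<le> 1"
begin

definition m :: "nat \<Rightarrow> complex" where "m k = (\<Sum>i\<in>A. z k i) / of_nat N"
definition y :: "nat \<Rightarrow> 'i \<Rightarrow> complex" where "y k i = z k i - m k"
definition T :: "nat set \<Rightarrow> complex" where
  "T K = permanent_mean A (map y (filter (\<lambda>k. k \<in> K) [1..<Suc n]))"

abbreviation "\<alpha> \<equiv> real n / real N"

lemma alpha: "0 < \<alpha>" "\<alpha> < 1" using n by auto

lemma N_pos: "real N > 0" using n by simp

lemma sum_y: "(\<Sum>i\<in>A. y k i) = 0"
  using N_pos by (simp add: y_def sum_subtractf card m_def)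

lemma mean_rms: assumes "k \<in> {1..n}" shows "(cmod (m k))\<^sup>2 + (rms A (y k))\<^sup>2 \<le> 1"
proof -
  have "complex_of_real (\<Sum>i\<in>A. (cmod (z k i))\<^sup>2) = (\<Sum>i\<in>A. (m k + y k i) * cnj (m k + y k i))"
    unfolding of_real_sum complex_norm_square by (simp add: y_def)
  also have "\<dots> = (\<Sum>i\<in>A. m k * cnj (m k)) + m k * cnj (\<Sum>i\<in>A. y k i) + cnj (m k) * (\<Sum>i\<in>A. y k i)
      + (\<Sum>i\<in>A. y k i * cnj (y k i))"
    unfolding cnj_sum sum_distrib_left sum.distrib[symmetric] by (simp add: algebra_simps)
  also have "\<dots> = complex_of_real (real N * (cmod (m k))\<^sup>2 + (\<Sum>i\<in>A. (cmod (y k i))\<^sup>2))"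
    unfolding sum_y of_real_add of_real_mult of_real_sum complex_norm_square by (simp add: card)
  finally have "(\<Sum>i\<in>A. (cmod (z k i))\<^sup>2) = real N * (cmod (m k))\<^sup>2 + (\<Sum>i\<in>A. (cmod (y k i))\<^sup>2)"
    by (simp only: of_real_eq_iff)
  moreover have "(\<Sum>i\<in>A. (cmod (z k i))\<^sup>2) \<le> (\<Sum>i\<in>A. 1)"
    using z[OF assms] by (intro sum_mono) (simp add: power_le_one)
  ultimately show ?thesis
    using N_pos by (simp add: rms_sq card field_simps)
qed

context
  fixes K assumes K: "K \<subseteq> {1..n}"
begin

lemma filter_props:
  "set (filter (\<lambda>k. k \<in> K) [1..<Suc n]) = K" "distinct (filter (\<lambda>k. k \<in> K) [1..<Suc n])"
  "length (filter (\<lambda>k. k \<in> K) [1..<Suc n]) = card K"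
proof -
  show 1: "set (filter (\<lambda>k. k \<in> K) [1..<Suc n]) = K" using K by auto
  show 2: "distinct (filter (\<lambda>k. k \<in> K) [1..<Suc n])" by simp
  show "length (filter (\<lambda>k. k \<in> K) [1..<Suc n]) = card K"
    using distinct_card[OF 2] 1 by simp
qed

lemma card_K: "card K \<le> n" using card_mono[OF _ K] by simp

lemma T_bound:
  assumes "0 < card K"
  shows "norm (T K) \<le> esym_bound N (card K) / real (N choose card K) * (\<Prod>k\<in>K. rms A (y k))"
proof -
  let ?l = "filter (\<lambda>k. k \<in> K) [1..<Suc n]"
  have "norm (permanent A (map y ?l)) \<le> fact (card K) * esym_bound N (card K) * prod_list (map (rms A) (map y ?l))"
  proof -
    have "norm (permanent A (map y ?l)) \<le> fact (length (map y ?l)) * esym_bound (card A) (length (map y ?l))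
        * prod_list (map (rms A) (map y ?l))"
      by (rule permanent_bound[OF fin])
         (use filter_props(3) assms card_K n sum_y card in \<open>auto simp del: upt_Suc\<close>)
    then show ?thesis unfolding length_map filter_props(3) card .
  qed
  also have "prod_list (map (rms A) (map y ?l)) = (\<Prod>k\<in>K. rms A (y k))"
    using prod.distinct_set_conv_list[OF filter_props(2), of "\<lambda>k. rms A (y k)"]
    unfolding filter_props(1) by (simp add: comp_def)
  finally have "norm (permanent A (map y ?l)) * (fact (N - card K) / fact N)
     \<le> fact (card K) * esym_bound N (card K) * (\<Prod>k\<in>K. rms A (y k)) * (fact (N - card K) / fact N)"
    by (intro mult_right_mono) auto
  then show ?thesis
    using card_K n
    unfolding T_def permanent_mean_def length_map filter_props(3) card
    by (simp add: norm_mult norm_divide binomial_fact field_simps del: upt_Suc)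
qed

lemma T_single: assumes "card K = 1" shows "T K = 0"
proof -
  have "length (filter (\<lambda>k. k \<in> K) [1..<Suc n]) = Suc 0"
    using filter_props(3) assms by simp
  then obtain a where "filter (\<lambda>k. k \<in> K) [1..<Suc n] = [a]"
    by (auto simp only: length_Suc_conv length_0_conv)
  then show ?thesis unfolding T_def permanent_mean_def by (simp add: sum_y)
qed

lemma T_pair: assumes "card K = 2"
  shows "T K = - (\<Sum>i\<in>A. \<Prod>k\<in>K. y k i) / (of_nat N * (of_nat N - 1))"
    and "norm (T K) \<le> 1 / (real N - 1) * (\<Prod>k\<in>K. rms A (y k))"
proof -
  have "length (filter (\<lambda>k. k \<in> K) [1..<Suc n]) = Suc (Suc 0)"
    using filter_props(3) assms by simp
  then obtain a b where ab: "filter (\<lambda>k. k \<in> K) [1..<Suc n] = [a, b]"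
    by (auto simp only: length_Suc_conv length_0_conv)
  have Kab: "K = {a, b}" "a \<noteq> b" using filter_props(1,2) unfolding ab by auto
  have N2: "N \<ge> 2" using n by simp
  then obtain M where NM: "N = Suc (Suc M)" by (auto dest: le_Suc_ex)
  have f: "fact (N - 2) / fact N = 1 / (of_nat N * (of_nat N - 1) :: complex)"
  proof -
    have "fact N = (of_nat N * (of_nat N - 1)) * (fact (N - 2) :: complex)"
      by (simp add: NM algebra_simps)
    then show ?thesis by simp
  qed
  have "T K = - (\<Sum>i\<in>A. y a i * y b i) * (fact (N - 2) / fact N)"
    unfolding T_def permanent_mean_def ab by (simp only: list.map permanent_pair[OF fin sum_y sum_y]) (simp add: card numeral_2_eq_2)
  then show 1: "T K = - (\<Sum>i\<in>A. \<Prod>k\<in>K. y k i) / (of_nat N * (of_nat N - 1))"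
    unfolding f using Kab by simp
  have "norm (\<Sum>i\<in>A. \<Prod>k\<in>K. y k i) \<le> real N * (\<Prod>k\<in>K. rms A (y k))"
    using norm_sum[of "\<lambda>i. y a i * y b i" A] sum_norm_mult_le_rms[OF fin, of "y a" "y b"] Kab
    by (simp add: card)
  moreover have "norm (of_nat N * (of_nat N - 1) :: complex) = real N * (real N - 1)"
  proof -
    have "(of_nat N * (of_nat N - 1) :: complex) = of_real (real N * (real N - 1))" by simp
    then show ?thesis using N2 unfolding norm_of_real by (simp only: norm_of_real) simp
  qed
  ultimately have "norm (T K) \<le> real N * (\<Prod>k\<in>K. rms A (y k)) / (real N * (real N - 1))"
    unfolding 1 norm_divide norm_minus_cancel using N2 by (simp only:) (intro divide_right_mono, auto)
  then show "norm (T K) \<le> 1 / (real N - 1) * (\<Prod>k\<in>K. rms A (y k))"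
    using N2 by simp
qed

text \<open>
  For centred columns the sum over distinct triples collapses to twice the sum over coinciding
  indices. In each term one factor is bounded by \<open>sqrt N\<close> times its root mean square, the other
  two are handled by Cauchy-Schwarz.
\<close>

lemma T_triple: assumes "card K = 3"
  shows "norm (T K) \<le> 2 * sqrt (real N) / ((real N - 1) * (real N - 2)) * (\<Prod>k\<in>K. rms A (y k))"
proof -
  have "length (filter (\<lambda>k. k \<in> K) [1..<Suc n]) = Suc (Suc (Suc 0))"
    using filter_props(3) assms by simp
  then obtain a b c where ab: "filter (\<lambda>k. k \<in> K) [1..<Suc n] = [a, b, c]"
    by (auto simp only: length_Suc_conv length_0_conv)
  have Kab: "K = {a, b, c}" "a \<noteq> b" "a \<noteq> c" "b \<noteq> c" using filter_props(1,2) unfolding ab by auto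
  have "N \<ge> 4" using n card_K assms by simp
  then obtain M where NM: "N = Suc (Suc (Suc M))"
    by (auto dest: le_Suc_ex)
  have f: "fact (N - 3) / fact N = 1 / (real N * (real N - 1) * (real N - 2))"
  proof -
    have "fact N = (real N * (real N - 1) * (real N - 2)) * fact (N - 3)"
      by (simp add: NM algebra_simps)
    then show ?thesis by simp
  qed
  have "norm (\<Sum>i\<in>A. y a i * y b i * y c i) \<le> (\<Sum>i\<in>A. (sqrt N * rms A (y a)) * cmod (y b i * y c i))"
    unfolding mult.assoc using norm_le_rms[OF fin, of _ "y a"] card
    by (intro sum_norm_le) (simp add: norm_mult mult_right_mono mult.assoc[symmetric])
  also have "\<dots> \<le> (sqrt N * rms A (y a)) * (real N * rms A (y b) * rms A (y c))"
    unfolding sum_distrib_left[symmetric]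
    by (intro mult_left_mono) (use sum_norm_mult_le_rms[OF fin, of "y b" "y c"] card in auto)
  also have "\<dots> = sqrt N * real N * (\<Prod>k\<in>K. rms A (y k))" using Kab by simp
  finally have 1: "norm (\<Sum>i\<in>A. y a i * y b i * y c i) \<le> sqrt N * real N * (\<Prod>k\<in>K. rms A (y k))" .
  have "T K = 2 * (\<Sum>i\<in>A. y a i * y b i * y c i) * (fact (N - 3) / fact N)"
    unfolding T_def permanent_mean_def ab by (simp only: list.map permanent_triple[OF fin sum_y sum_y sum_y]) (simp add: card numeral_3_eq_3)
  then have "norm (T K) = 2 * norm (\<Sum>i\<in>A. y a i * y b i * y c i) * (fact (N - 3) / fact N)"
    by (simp add: norm_mult norm_divide)
  also have "\<dots> \<le> 2 * (sqrt N * real N * (\<Prod>k\<in>K. rms A (y k))) * (fact (N - 3) / fact N)"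
    by (intro mult_right_mono mult_left_mono 1) auto
  also have "\<dots> = 2 * sqrt (real N) / ((real N - 1) * (real N - 2)) * (\<Prod>k\<in>K. rms A (y k))"
    unfolding f by simp
  finally show ?thesis .
qed

end

lemma sqrt_alpha_power: "sqrt (\<alpha> ^ r) = \<alpha> powr (r / 2)"
proof -
  have "sqrt (\<alpha> ^ r) = (\<alpha> powr r) powr (1 / 2)"
    using alpha by (simp add: powr_half_sqrt powr_realpow)
  then show ?thesis by (simp only: powr_powr) simp
qed

text \<open>
  The part of the expansion of the permanent that is homogeneous of degree \<open>r\<close> in the centred
  columns; \<open>tail_sum\<close> collects all degrees from a given one on.
\<close>

definition level_sum :: "nat \<Rightarrow> complex" where
  "level_sum r = (\<Sum>K | K \<subseteq> {1..n} \<and> card K = r. (\<Prod>k\<in>{1..n} - K. m k) * T K)"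

definition tail_sum :: "nat \<Rightarrow> complex" where
  "tail_sum r = (\<Sum>K | K \<subseteq> {1..n} \<and> r \<le> card K. (\<Prod>k\<in>{1..n} - K. m k) * T K)"

lemma tail_sum_Suc: "tail_sum r = level_sum r + tail_sum (Suc r)"
proof -
  have "{K. K \<subseteq> {1..n} \<and> r \<le> card K} = {K. K \<subseteq> {1..n} \<and> card K = r} \<union> {K. K \<subseteq> {1..n} \<and> Suc r \<le> card K}"
    by auto
  then show ?thesis unfolding tail_sum_def level_sum_def by (simp only:) (rule sum.union_disjoint, auto)
qed

lemma permanent_mean_eq_tail_sum: "permanent_mean A (map z [1..<Suc n]) = tail_sum 0"
proof -
  have "z = (\<lambda>k i. m k + y k i)" by (simp add: y_def fun_eq_iff)
  moreover have "{K. K \<subseteq> {1..n} \<and> 0 \<le> card K} = Pow (set [1..<Suc n])" by auto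
  moreover have "set [1..<Suc n] = {1..n}" by auto
  ultimately show ?thesis
    using permanent_mean_expand[OF fin, of "[1..<Suc n]" m y] n card
    unfolding tail_sum_def T_def by (simp only: distinct_upt length_upt)
qed

lemma level_sum_0: "level_sum 0 = (\<Prod>k\<in>{1..n}. m k)"
proof -
  have "{K. K \<subseteq> {1..n} \<and> card K = 0} = {{}}" by (auto dest: finite_subset)
  moreover have "T {} = 1" by (simp add: T_def permanent_mean_def)
  ultimately show ?thesis by (simp add: level_sum_def)
qed

lemma level_sum_1: "level_sum 1 = 0"
  unfolding level_sum_def by (rule sum.neutral) (simp add: T_single[unfolded One_nat_def])

lemma permanent_mean_centred: "permanent_mean A (map z [1..<Suc n]) - (\<Prod>k\<in>{1..n}. m k) = tail_sum 2"
proof -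
  have "tail_sum 0 = level_sum 0 + (level_sum 1 + tail_sum 2)"
    using tail_sum_Suc[of 0] tail_sum_Suc[of 1] by (simp add: numeral_2_eq_2)
  then show ?thesis unfolding permanent_mean_eq_tail_sum level_sum_0 level_sum_1 by (simp only: add_0 add_diff_cancel_left')
qed

text \<open>
  The correction term in the definition of \<open>Q2\<close>, for a fixed outcome.
\<close>

lemma level_sum_2_eq:
  "level_sum 2 = - (\<Sum>K\<in>{K. K \<subseteq> {1..n} \<and> card K = 2}. \<Sum>i\<in>A. (\<Prod>k\<in>K. y k i) * (\<Prod>k\<in>{1..n} - K. m k))
       / (of_nat N * (of_nat N - 1))"
  unfolding level_sum_def sum_negf[symmetric] sum_divide_distrib
  by (intro sum.cong refl) (simp add: T_pair(1) sum_distrib_left sum_distrib_right sum_divide_distrib sum_negf mult_ac)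

lemma level_sum_bound:
  assumes "\<And>K. K \<subseteq> {1..n} \<Longrightarrow> card K = r \<Longrightarrow> norm (T K) \<le> b * (\<Prod>k\<in>K. rms A (y k))" "b \<ge> 0"
  shows "norm (level_sum r) \<le> sqrt (real (n choose r) * b\<^sup>2)"
proof -
  have "norm (level_sum r) \<le> sqrt (\<Sum>K | K \<subseteq> {1..n} \<and> card K = r. b\<^sup>2)"
    unfolding level_sum_def
    by (rule subset_expansion_bound[where v = "\<lambda>k. rms A (y k)" and b = "\<lambda>_. b"]) (use assms mean_rms in auto)
  also have "(\<Sum>K | K \<subseteq> {1..n} \<and> card K = r. b\<^sup>2) = real (n choose r) * b\<^sup>2"
    by (simp add: n_subsets)
  finally show ?thesis .
qed

lemma level_sum_2_le: "norm (level_sum 2) \<le> \<alpha>"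
proof -
  have N: "real N \<ge> 2" using n by simp
  have "norm (level_sum 2) \<le> sqrt (real (n choose 2) * (1 / (real N - 1))\<^sup>2)"
    by (rule level_sum_bound[OF T_pair(2)]) (use N in auto)
  also have "\<dots> \<le> sqrt (\<alpha>\<^sup>2)"
  proof (rule real_sqrt_le_mono)
    have "real (n choose 2) \<le> \<alpha>\<^sup>2 * real (N choose 2)"
      using binomial_ratio_le[of n N 2] n by (simp add: divide_le_eq)
    then have "real (n choose 2) * (1 / (real N - 1))\<^sup>2 \<le> \<alpha>\<^sup>2 * real (N choose 2) * (1 / (real N - 1))\<^sup>2"
      by (intro mult_right_mono) auto
    also have "real (N choose 2) = real N * (real N - 1) / 2"
      using n by (simp add: choose_two real_of_nat_div of_nat_diff)
    also have "\<alpha>\<^sup>2 * (real N * (real N - 1) / 2) * (1 / (real N - 1))\<^sup>2 = \<alpha>\<^sup>2 * (real N / (2 * (real N - 1)))"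
      using N by (simp add: power2_eq_square)
    also have "\<dots> \<le> \<alpha>\<^sup>2 * 1" using N by (intro mult_left_mono) auto
    finally show "real (n choose 2) * (1 / (real N - 1))\<^sup>2 \<le> \<alpha>\<^sup>2" by simp
  qed
  finally show ?thesis using alpha by simp
qed

text \<open>
  Directly from the explicit bound for triples: the constant \<open>s(3) > 3\<close> of the general estimate
  would be too large here.
\<close>

lemma level_sum_3_le: "norm (level_sum 3) \<le> sqrt 3 * \<alpha> powr (3/2)"
proof (cases "n \<ge> 3")
  case False
  then have "card K \<noteq> 3" if "K \<subseteq> {1..n}" for K
    using card_K[OF that] by simp
  then have "{K. K \<subseteq> {1..n} \<and> card K = 3} = {}" by blast
  then have "level_sum 3 = 0" unfolding level_sum_def by (simp only: sum.empty)
  then show ?thesis by simp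
next
  case True
  then have N: "real N \<ge> 4" using n by simp
  have "norm (level_sum 3) \<le> sqrt (real (n choose 3) * (2 * sqrt (real N) / ((real N - 1) * (real N - 2)))\<^sup>2)"
    by (rule level_sum_bound[OF T_triple]) (use N in auto)
  also have "\<dots> \<le> sqrt (3 * \<alpha> ^ 3)"
  proof (rule real_sqrt_le_mono)
    have s: "(2 * sqrt (real N) / ((real N - 1) * (real N - 2)))\<^sup>2 = 4 * real N / ((real N - 1)\<^sup>2 * (real N - 2)\<^sup>2)"
      using N by (simp add: power_divide power_mult_distrib)
    have "real (n choose 3) \<le> \<alpha> ^ 3 * real (N choose 3)"
      using binomial_ratio_le[of n N 3] n N by (simp add: divide_le_eq)
    then have "real (n choose 3) * (2 * sqrt (real N) / ((real N - 1) * (real N - 2)))\<^sup>2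
        \<le> \<alpha> ^ 3 * real (N choose 3) * (4 * real N / ((real N - 1)\<^sup>2 * (real N - 2)\<^sup>2))"
      unfolding s by (intro mult_right_mono) auto
    also have "real (N choose 3) = real N * (real N - 1) * (real N - 2) / 6"
    proof -
      have "3 \<le> N" using True n by simp
      then obtain M where "N = Suc (Suc (Suc M))" by (auto dest: le_Suc_ex)
      then have "fact N = (real N * (real N - 1) * (real N - 2)) * fact (N - 3)"
        by (simp add: algebra_simps)
      moreover have "real (N choose 3) = fact N / (fact 3 * fact (N - 3))"
        using \<open>3 \<le> N\<close> by (rule binomial_fact)
      ultimately show ?thesis by (simp add: fact_numeral)
    qed
    also have "\<alpha> ^ 3 * (real N * (real N - 1) * (real N - 2) / 6) * (4 * real N / ((real N - 1)\<^sup>2 * (real N - 2)\<^sup>2))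
       = \<alpha> ^ 3 * (2 * (real N)\<^sup>2 / (3 * (real N - 1) * (real N - 2)))"
    proof -
      have c: "x * a * b / 6 * (4 * x / (a\<^sup>2 * b\<^sup>2)) = 2 * x\<^sup>2 / (3 * a * b)" if "a > 0" "b > 0" for x a b :: real
        using that by (simp add: power2_eq_square)
      have "real N * (real N - 1) * (real N - 2) / 6 * (4 * real N / ((real N - 1)\<^sup>2 * (real N - 2)\<^sup>2))
         = 2 * (real N)\<^sup>2 / (3 * (real N - 1) * (real N - 2))" by (rule c) (use N in auto)
      then show ?thesis by (simp only: mult.assoc)
    qed
    also have "\<dots> \<le> \<alpha> ^ 3 * 3"
    proof (rule mult_left_mono)
      \<comment> \<open>Only \<open>N \<ge> 4\<close> occurs, since \<open>3 \<le> n < N\<close>.\<close>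
      have "0 \<le> (real N - 4) * (7 * real N + 1)" using N by (intro mult_nonneg_nonneg) auto
      then have "2 * (real N)\<^sup>2 \<le> 3 * (3 * (real N - 1) * (real N - 2))"
        by (simp add: power2_eq_square algebra_simps)
      then show "2 * (real N)\<^sup>2 / (3 * (real N - 1) * (real N - 2)) \<le> 3"
        using N by (simp add: divide_le_eq)
    qed auto
    finally show "real (n choose 3) * (2 * sqrt (real N) / ((real N - 1) * (real N - 2)))\<^sup>2 \<le> 3 * \<alpha> ^ 3"
      by simp
  qed
  also have "\<dots> = sqrt 3 * \<alpha> powr (3/2)"
    using sqrt_alpha_power[of 3] by (simp only: real_sqrt_mult) simp
  finally show ?thesis .
qed

lemma tail_sum_le:
  assumes "r > 0" "stirling_ratio r \<le> C\<^sup>2" "C \<ge> 0"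
  shows "norm (tail_sum r) \<le> C * (\<alpha> powr (r/2) / (1 - \<alpha>) powr (3/4))"
proof -
  let ?b = "\<lambda>r. esym_bound N r / real (N choose r)"
  have "norm (tail_sum r) \<le> sqrt (\<Sum>K | K \<subseteq> {1..n} \<and> r \<le> card K. (?b (card K))\<^sup>2)"
    unfolding tail_sum_def
    by (rule subset_expansion_bound[where v = "\<lambda>k. rms A (y k)" and b = ?b]) (use assms mean_rms T_bound in auto)
  also have "\<dots> \<le> sqrt (C\<^sup>2 * \<alpha> ^ r * (1 - \<alpha>) powr (- 3 / 2))"
  proof (rule real_sqrt_le_mono)
    have "(\<Sum>K | K \<subseteq> {1..n} \<and> r \<le> card K. (?b (card K))\<^sup>2) = (\<Sum>r=r..n. real (n choose r) * (?b r)\<^sup>2)"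
      using sum_subsets_card[of "{1..n}" "\<lambda>r. (?b r)\<^sup>2" r] by simp
    also have "\<dots> \<le> (\<Sum>r=r..n. stirling_ratio r * \<alpha> ^ r)"
      by (intro sum_mono esym_bound_binomial_le) (use assms n in auto)
    also have "\<dots> \<le> stirling_ratio r * \<alpha> ^ r * (1 - \<alpha>) powr (- 3 / 2)"
      by (rule stirling_ratio_sum_le) (use assms alpha in auto)
    also have "\<dots> \<le> C\<^sup>2 * \<alpha> ^ r * (1 - \<alpha>) powr (- 3 / 2)"
      using alpha by (intro mult_right_mono assms(2)) auto
    finally show "(\<Sum>K | K \<subseteq> {1..n} \<and> r \<le> card K. (?b (card K))\<^sup>2) \<le> C\<^sup>2 * \<alpha> ^ r * (1 - \<alpha>) powr (- 3 / 2)" .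
  qed
  also have "\<dots> = C * (\<alpha> powr (r/2) / (1 - \<alpha>) powr (3/4))"
  proof -
    have "sqrt ((1 - \<alpha>) powr (- 3 / 2)) = ((1 - \<alpha>) powr (- 3 / 2)) powr (1 / 2)"
      by (rule powr_half_sqrt[symmetric]) simp
    also have "\<dots> = (1 - \<alpha>) powr (- (3 / 4))" by (simp only: powr_powr) simp
    finally show ?thesis using assms(3)
      by (simp only: real_sqrt_mult sqrt_alpha_power powr_minus_divide) simp
  qed
  finally show ?thesis .
qed

theorem first_order:
  "norm (permanent_mean A (map z [1..<Suc n]) - (\<Prod>k\<in>{1..n}. m k))
     \<le> \<alpha> + 2.12 * (\<alpha> powr (3/2) / (1 - \<alpha>) powr (3/4))"
proof -
  have "tail_sum 2 = level_sum 2 + tail_sum 3" using tail_sum_Suc[of 2] by simp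
  then have "norm (tail_sum 2) \<le> norm (level_sum 2) + norm (tail_sum 3)" by (simp only: norm_triangle_ineq)
  moreover have "norm (tail_sum 3) \<le> 2.12 * (\<alpha> powr (real 3 / 2) / (1 - \<alpha>) powr (3/4))"
    by (rule tail_sum_le[OF _ stirling_ratio_3]) auto
  ultimately show ?thesis unfolding permanent_mean_centred using level_sum_2_le by simp
qed

theorem second_order:
  "norm (permanent_mean A (map z [1..<Suc n]) - (\<Prod>k\<in>{1..n}. m k)
      + (\<Sum>K\<in>{K. K \<subseteq> {1..n} \<and> card K = 2}. \<Sum>i\<in>A. (\<Prod>k\<in>K. y k i) * (\<Prod>k\<in>{1..n} - K. m k))
       / (of_nat N * (of_nat N - 1)))
     \<le> sqrt 3 * \<alpha> powr (3/2) + 2.27 * (\<alpha>\<^sup>2 / (1 - \<alpha>) powr (3/4))"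
proof -
  have "tail_sum 2 - level_sum 2 = level_sum 3 + tail_sum 4" using tail_sum_Suc[of 2] tail_sum_Suc[of 3] by simp
  then have 1: "norm (tail_sum 2 - level_sum 2) \<le> norm (level_sum 3) + norm (tail_sum 4)" by (simp only: norm_triangle_ineq)
  have 2: "norm (tail_sum 4) \<le> 2.27 * (\<alpha> powr (real 4 / 2) / (1 - \<alpha>) powr (3/4))"
    by (rule tail_sum_le[OF _ stirling_ratio_4]) auto
  have 3: "\<alpha> powr (real 4 / 2) = \<alpha>\<^sup>2" using alpha by (simp add: powr_numeral)
  have 4: "a + x / c = a - (- x / c)" for a x c :: complex by simp
  show ?thesis unfolding permanent_mean_centred 4 level_sum_2_eq[symmetric] using 1 2[unfolded 3] level_sum_3_le by linarith
qed

end

section \<open>Integration against finite signed measures\<close>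

lemma finite_signed_measure_sum:
  fixes M :: "'a measure"
  assumes D: "\<And>f. f \<in> F \<Longrightarrow> finite_measure (D f)" "\<And>f. f \<in> F \<Longrightarrow> sets (D f) = sets M"
  shows "finite_signed_measure M (\<lambda>A. \<Sum>f\<in>F. c f * measure (D f) A)"
  unfolding finite_signed_measure_def
proof (intro conjI allI impI)
  fix A :: "nat \<Rightarrow> 'a set" assume A: "range A \<subseteq> sets M" "disjoint_family A"
  show "(\<lambda>i. \<Sum>f\<in>F. c f * measure (D f) (A i)) sums (\<Sum>f\<in>F. c f * measure (D f) (\<Union>i. A i))"
    by (intro sums_sum sums_mult finite_measure.finite_measure_UNION D) (use A D in auto)
qed (use D in \<open>auto simp: measure_notin_sets intro!: sum.neutral\<close>)

lemma signed_union:
  assumes fsm: "finite_signed_measure M \<nu>"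
    and "A \<in> sets M" "B \<in> sets M" "A \<inter> B = {}"
  shows "\<nu> (A \<union> B) = \<nu> A + \<nu> B"
proof -
  have "range (binaryset A B) \<subseteq> sets M" "disjoint_family (binaryset A B)"
    using assms by (auto simp: range_binaryset_eq disjoint_family_on_def binaryset_def)
  then have "(\<lambda>i. \<nu> (binaryset A B i)) sums \<nu> (\<Union>i. binaryset A B i)"
    using fsm by (simp add: finite_signed_measure_def)
  then have "(\<lambda>i. \<nu> (binaryset A B i)) sums \<nu> (A \<union> B)"
    by (simp only: UN_binaryset_eq)
  moreover have "(\<lambda>i. \<nu> (binaryset A B i)) sums (\<nu> A + \<nu> B)"
    using fsm by (intro binaryset_sums) (simp add: finite_signed_measure_def)
  ultimately show ?thesis by (rule sums_unique2)
qed

lemma signed_restrict: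
  assumes fsm: "finite_signed_measure M \<nu>"
    and "Y \<in> sets M"
  shows "finite_signed_measure M (\<lambda>A. if A \<in> sets M then \<nu> (A \<inter> Y) else 0)"
  unfolding finite_signed_measure_def
proof (intro conjI allI impI)
  fix A :: "nat \<Rightarrow> 'a set" assume A: "range A \<subseteq> sets M" "disjoint_family A"
  have "range (\<lambda>i. A i \<inter> Y) \<subseteq> sets M" "disjoint_family (\<lambda>i. A i \<inter> Y)"
    using A assms by (auto simp: disjoint_family_on_def)
  then have "(\<lambda>i. \<nu> (A i \<inter> Y)) sums \<nu> (\<Union>i. A i \<inter> Y)"
    using fsm unfolding finite_signed_measure_def by blast
  moreover have "(\<Union>i. A i \<inter> Y) = (\<Union>i. A i) \<inter> Y" by auto
  ultimately have "(\<lambda>i. \<nu> (A i \<inter> Y)) sums \<nu> ((\<Union>i. A i) \<inter> Y)" by (simp only:)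
  moreover have "A i \<in> sets M" "(\<Union>i. A i) \<in> sets M" for i using A by auto
  ultimately show "(\<lambda>i. if A i \<in> sets M then \<nu> (A i \<inter> Y) else 0) sums
      (if (\<Union>i. A i) \<in> sets M then \<nu> ((\<Union>i. A i) \<inter> Y) else 0)" by simp
qed (use fsm in \<open>auto simp: finite_signed_measure_def\<close>)

lemma emeasure_of_signed:
  assumes fsm: "finite_signed_measure M \<nu>"
    and "\<And>A. A \<in> sets M \<Longrightarrow> \<nu> A \<ge> 0" "A \<in> sets M"
  shows "emeasure (measure_of (space M) (sets M) (\<lambda>A. ennreal (\<nu> A))) A = ennreal (\<nu> A)"
proof (rule emeasure_measure_of_sigma)
  show "countably_additive (sets M) (\<lambda>A. ennreal (\<nu> A))"
    unfolding countably_additive_def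
  proof (intro allI impI)
    fix A :: "nat \<Rightarrow> 'a set" assume A: "range A \<subseteq> sets M" "disjoint_family A"
    then have "(\<lambda>i. \<nu> (A i)) sums \<nu> (\<Union>i. A i)"
      using fsm by (simp add: finite_signed_measure_def)
    then show "(\<Sum>i. ennreal (\<nu> (A i))) = ennreal (\<nu> (\<Union>i. A i))"
      using A by (intro suminf_ennreal_eq assms) auto
  qed
qed (use assms fsm sets.sigma_algebra_axioms in \<open>auto simp: positive_def finite_signed_measure_def\<close>)

text \<open>
  If \<open>Y\<close> is the positive set of a Hahn decomposition, the supremum that defines the upper
  variation of \<open>A\<close> is attained at \<open>A \<inter> Y\<close>. In particular the defining set function is a measure.
\<close>

lemma upper_variation_Hahn:
  assumes fsm: "finite_signed_measure M \<nu>"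
    and Y: "Y \<in> sets M" "\<And>X. X \<in> sets M \<Longrightarrow> X \<subseteq> Y \<Longrightarrow> \<nu> X \<ge> 0"
      "\<And>X. X \<in> sets M \<Longrightarrow> X \<inter> Y = {} \<Longrightarrow> \<nu> X \<le> 0"
    and A: "A \<in> sets M"
  shows "emeasure (upper_variation M \<nu>) A = ennreal (\<nu> (A \<inter> Y))"
proof -
  let ?\<mu> = "\<lambda>A. if A \<in> sets M then \<nu> (A \<inter> Y) else 0"
  have "(SUP B\<in>{B \<in> sets M. B \<subseteq> A}. ennreal (\<nu> B)) = ennreal (?\<mu> A)" if "A \<in> sets M" for A
  proof (rule antisym)
    show "(SUP B\<in>{B \<in> sets M. B \<subseteq> A}. ennreal (\<nu> B)) \<le> ennreal (?\<mu> A)"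
    proof (rule SUP_least)
      fix B assume "B \<in> {B \<in> sets M. B \<subseteq> A}"
      then have B: "B \<in> sets M" "B \<subseteq> A" by auto
      have "\<nu> B = \<nu> (B \<inter> Y) + \<nu> (B - Y)"
        using signed_union[OF fsm, of "B \<inter> Y" "B - Y"] B Y(1) by (simp add: Int_Diff_Un Int_Diff_disjoint)
      also have "\<nu> (B - Y) \<le> 0" by (rule Y) (use B Y(1) in auto)
      also have "\<nu> (B \<inter> Y) + 0 \<le> \<nu> (B \<inter> Y) + \<nu> ((A - B) \<inter> Y)"
        using Y(2)[of "(A - B) \<inter> Y"] B Y(1) that by auto
      also have "\<dots> = \<nu> ((B \<inter> Y) \<union> ((A - B) \<inter> Y))"
        by (rule signed_union[OF fsm, symmetric]) (use B Y(1) that in auto)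
      also have "(B \<inter> Y) \<union> ((A - B) \<inter> Y) = A \<inter> Y" using B by auto
      finally show "ennreal (\<nu> B) \<le> ennreal (?\<mu> A)" using that by (simp add: ennreal_leI)
    qed
    show "ennreal (?\<mu> A) \<le> (SUP B\<in>{B \<in> sets M. B \<subseteq> A}. ennreal (\<nu> B))"
      using that Y(1) by (auto intro!: SUP_upper2[of "A \<inter> Y"])
  qed
  then have "upper_variation M \<nu> = measure_of (space M) (sets M) (\<lambda>A. ennreal (?\<mu> A))"
    unfolding upper_variation_def
    by (intro measure_of_eq) (auto simp: sets.space_closed sets.sigma_sets_eq)
  also have "emeasure \<dots> A = ennreal (?\<mu> A)"
    by (rule emeasure_of_signed[OF signed_restrict[OF fsm Y(1)] _ A]) (use Y in auto)
  finally show ?thesis using A by simp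
qed

lemma sets_upper_variation [simp]: "sets (upper_variation M \<nu>) = sets M"
  by (simp add: upper_variation_def)

lemma space_upper_variation [simp]: "space (upper_variation M \<nu>) = space M"
  by (simp add: upper_variation_def sets.space_closed)

lemma finite_signed_measure_uminus:
  "finite_signed_measure M \<nu> \<Longrightarrow> finite_signed_measure M (\<lambda>A. - \<nu> A)"
  by (auto simp: finite_signed_measure_def intro: sums_minus)

text \<open>
  A difference of two finite measures has a Hahn decomposition, and the complement of its
  positive set serves \<open>- \<nu>\<close>.
\<close>

lemma jordan_decomposition:
  assumes 1: "finite_signed_measure M \<sigma>" "\<And>A. A \<in> sets M \<Longrightarrow> \<sigma> A \<ge> 0"
    and 2: "finite_signed_measure M \<tau>" "\<And>A. A \<in> sets M \<Longrightarrow> \<tau> A \<ge> 0"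
    and \<nu>: "finite_signed_measure M \<nu>" "\<And>A. A \<in> sets M \<Longrightarrow> \<nu> A = \<sigma> A - \<tau> A"
  shows "finite_measure (upper_variation M \<nu>)" "finite_measure (upper_variation M (\<lambda>A. - \<nu> A))"
    "\<And>A. A \<in> sets M \<Longrightarrow> measure (upper_variation M \<nu>) A - measure (upper_variation M (\<lambda>A. - \<nu> A)) A = \<nu> A"
proof -
  define M1 where "M1 = measure_of (space M) (sets M) (\<lambda>A. ennreal (\<sigma> A))"
  define M2 where "M2 = measure_of (space M) (sets M) (\<lambda>A. ennreal (\<tau> A))"
  have e1: "emeasure M1 A = ennreal (\<sigma> A)" if "A \<in> sets M" for A
    unfolding M1_def by (rule emeasure_of_signed[OF 1 that])
  have e2: "emeasure M2 A = ennreal (\<tau> A)" if "A \<in> sets M" for A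
    unfolding M2_def by (rule emeasure_of_signed[OF 2 that])
  have s: "sets M1 = sets M" "sets M2 = sets M" by (simp_all add: M1_def M2_def)
  have sp: "space M1 = space M" "space M2 = space M" using s sets_eq_imp_space_eq by blast+
  have "finite_measure M1" "finite_measure M2"
    by (auto intro!: finite_measureI simp: sp e1 e2)
  then obtain Y where Y: "Y \<in> sets M1"
      "\<And>X. X \<in> sets M1 \<Longrightarrow> X \<subseteq> Y \<Longrightarrow> emeasure M2 X \<le> emeasure M1 X"
      "\<And>X. X \<in> sets M1 \<Longrightarrow> X \<inter> Y = {} \<Longrightarrow> emeasure M1 X \<le> emeasure M2 X"
    using finite_unsigned_Hahn_decomposition[of M1 M2] s by metis
  have Yp: "Y \<in> sets M" "\<And>X. X \<in> sets M \<Longrightarrow> X \<subseteq> Y \<Longrightarrow> \<nu> X \<ge> 0"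
      "\<And>X. X \<in> sets M \<Longrightarrow> X \<inter> Y = {} \<Longrightarrow> \<nu> X \<le> 0"
  proof -
    show "Y \<in> sets M" using Y s by simp
    show "\<nu> X \<ge> 0" if "X \<in> sets M" "X \<subseteq> Y" for X
      using Y(2)[of X] that s e1 e2 \<nu>(2) 1 2 by (simp add: ennreal_le_iff)
    show "\<nu> X \<le> 0" if "X \<in> sets M" "X \<inter> Y = {}" for X
      using Y(3)[of X] that s e1 e2 \<nu>(2) 1 2 by (simp add: ennreal_le_iff)
  qed
  have p: "emeasure (upper_variation M \<nu>) A = ennreal (\<nu> (A \<inter> Y))" if "A \<in> sets M" for A
    by (rule upper_variation_Hahn[OF \<nu>(1) Yp that])
  have q: "emeasure (upper_variation M (\<lambda>A. - \<nu> A)) A = ennreal (- \<nu> (A \<inter> (space M - Y)))" if "A \<in> sets M" for A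
  proof (rule upper_variation_Hahn[OF finite_signed_measure_uminus[OF \<nu>(1)] _ _ _ that])
    show "space M - Y \<in> sets M" using Yp(1) by auto
    show "0 \<le> - \<nu> X" if "X \<in> sets M" "X \<subseteq> space M - Y" for X
      using Yp(3)[of X] that by auto
    show "- \<nu> X \<le> 0" if "X \<in> sets M" "X \<inter> (space M - Y) = {}" for X
      using Yp(2)[of X] that sets.sets_into_space[OF that(1)] by auto
  qed
  show "finite_measure (upper_variation M \<nu>)" "finite_measure (upper_variation M (\<lambda>A. - \<nu> A))"
    by (auto intro!: finite_measureI simp: p q)
  fix A assume A: "A \<in> sets M"
  have AY: "A \<inter> (space M - Y) = A - Y" using sets.sets_into_space[OF A] by auto
  have "\<nu> A = \<nu> (A \<inter> Y) + \<nu> (A - Y)"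
    using signed_union[OF \<nu>(1), of "A \<inter> Y" "A - Y"] A Yp(1) by (simp add: Int_Diff_Un Int_Diff_disjoint)
  moreover have "\<nu> (A \<inter> Y) \<ge> 0" "\<nu> (A - Y) \<le> 0"
    using Yp(2)[of "A \<inter> Y"] Yp(3)[of "A - Y"] Yp(1) A by auto
  ultimately show "measure (upper_variation M \<nu>) A - measure (upper_variation M (\<lambda>A. - \<nu> A)) A = \<nu> A"
    by (simp add: measure_def p[OF A] q[OF A] AY)
qed

lemma integral_simple_function:
  fixes s :: "'a \<Rightarrow> complex"
  assumes "finite_measure \<mu>" "simple_function \<mu> s"
  shows "(\<integral>x. s x \<partial>\<mu>) = (\<Sum>v\<in>s ` space \<mu>. of_real (measure \<mu> {x \<in> space \<mu>. s x = v}) * v)"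
proof -
  interpret finite_measure \<mu> by fact
  have "Bochner_Integration.simple_bochner_integrable \<mu> s"
    by (rule simple_bochner_integrable.intros[OF assms(2)]) simp
  then have "(\<integral>x. s x \<partial>\<mu>) = Bochner_Integration.simple_bochner_integral \<mu> s"
    by (simp only: simple_bochner_integrable_eq_integral)
  then show ?thesis by (simp add: simple_bochner_integral_def scaleR_conv_of_real)
qed

text \<open>
  The Jordan parts satisfy the same linear relation with the measures \<open>D f\<close> on every measurable
  set. It passes to integrals of simple functions, and by dominated convergence to bounded
  measurable functions. This avoids an explicit formula for the parts, which depend on
  cancellations between the terms of the sum.
\<close>

lemma signed_integral_eq_sum:
  fixes M :: "'a measure" and h :: "'a \<Rightarrow> complex"
  assumes F: "finite F"
    and D: "\<And>f. f \<in> F \<Longrightarrow> finite_measure (D f)" "\<And>f. f \<in> F \<Longrightarrow> sets (D f) = sets M"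
    and h: "h \<in> borel_measurable M" "\<And>x. x \<in> space M \<Longrightarrow> norm (h x) \<le> B"
    and \<nu>: "\<And>A. A \<in> sets M \<Longrightarrow> \<nu> A = (\<Sum>f\<in>F. c f * measure (D f) A)"
  shows "signed_integral M \<nu> h = (\<Sum>f\<in>F. of_real (c f) * (\<integral>x. h x \<partial>D f))"
proof -
  define \<nu>' where "\<nu>' = (\<lambda>A. \<Sum>f\<in>F. c f * measure (D f) A)"
  have cong: "upper_variation M \<nu> = upper_variation M \<nu>'"
    "upper_variation M (\<lambda>A. - \<nu> A) = upper_variation M (\<lambda>A. - \<nu>' A)"
    unfolding upper_variation_def \<nu>'_def
    by (intro measure_of_eq SUP_cong refl; auto simp: sets.space_closed \<nu>)+
  define U1 where "U1 = upper_variation M \<nu>'"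
  define U2 where "U2 = upper_variation M (\<lambda>A. - \<nu>' A)"
  let ?p = "\<lambda>A. \<Sum>f\<in>F. max 0 (c f) * measure (D f) A"
  let ?n = "\<lambda>A. \<Sum>f\<in>F. max 0 (- c f) * measure (D f) A"
  have diff: "\<nu>' A = ?p A - ?n A" for A
    unfolding \<nu>'_def sum_subtractf[symmetric] left_diff_distrib[symmetric]
    by (intro sum.cong refl) (auto simp: max_def)
  have fsm: "finite_signed_measure M ?p" "finite_signed_measure M ?n" "finite_signed_measure M \<nu>'"
    unfolding \<nu>'_def by (intro finite_signed_measure_sum D; assumption)+
  have nonneg: "?p A \<ge> 0" "?n A \<ge> 0" for A by (auto intro!: sum_nonneg)
  note J = jordan_decomposition[OF fsm(1) nonneg(1) fsm(2) nonneg(2) fsm(3) diff,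
      folded U1_def U2_def]
  have sU: "sets U1 = sets M" "sets U2 = sets M" "space U1 = space M" "space U2 = space M"
    by (simp_all add: U1_def U2_def)
  have sD: "space (D f) = space M" if "f \<in> F" for f
    using D(2)[OF that] by (rule sets_eq_imp_space_eq)
  obtain s where s: "\<And>i. simple_function M (s i)" "\<And>x. x \<in> space M \<Longrightarrow> (\<lambda>i. s i x) \<longlonglongrightarrow> h x"
    "\<And>i x. x \<in> space M \<Longrightarrow> dist (s i x) 0 \<le> 2 * dist (h x) 0"
    using borel_measurable_implies_sequence_metric[OF h(1), of 0] by metis
  have sB: "norm (s i x) \<le> 2 * B" if "x \<in> space M" for i x
    using s(3)[OF that, of i] h(2)[OF that] by simp
  have sf: "simple_function \<mu> (s i)" if "sets \<mu> = sets M" for \<mu> i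
    using s(1)[of i] that sets_eq_imp_space_eq[OF that] by (simp add: simple_function_def)
  have lim: "(\<lambda>i. \<integral>x. s i x \<partial>\<mu>) \<longlonglongrightarrow> (\<integral>x. h x \<partial>\<mu>)" if "sets \<mu> = sets M" "finite_measure \<mu>" for \<mu>
  proof (rule integral_dominated_convergence[where w = "\<lambda>_. 2 * B"])
    have sp: "space \<mu> = space M" by (rule sets_eq_imp_space_eq[OF that(1)])
    show "h \<in> borel_measurable \<mu>" using h(1) that(1) by (simp cong: measurable_cong_sets)
    show "s i \<in> borel_measurable \<mu>" for i
      using sf[OF that(1)] by (rule borel_measurable_simple_function)
    show "integrable \<mu> (\<lambda>_. 2 * B)" using that(2) by (simp add: finite_measure.integrable_const)
    show "AE x in \<mu>. (\<lambda>i. s i x) \<longlonglongrightarrow> h x" using s(2) sp by (intro AE_I2) auto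
    show "AE x in \<mu>. norm (s i x) \<le> 2 * B" for i using sB sp by (intro AE_I2) auto
  qed
  have eq: "(\<integral>x. s i x \<partial>U1) - (\<integral>x. s i x \<partial>U2) = (\<Sum>f\<in>F. of_real (c f) * (\<integral>x. s i x \<partial>D f))" for i
  proof -
    let ?E = "\<lambda>v. {x \<in> space M. s i x = v}"
    have m: "?E v \<in> sets M" for v
      using borel_measurable_simple_function[OF s(1)[of i]] by measurable
    have "(\<integral>x. s i x \<partial>U1) - (\<integral>x. s i x \<partial>U2)
       = (\<Sum>v\<in>s i ` space M. of_real (measure U1 (?E v) - measure U2 (?E v)) * v)"
      using integral_simple_function[OF J(1) sf[OF sU(1)]] integral_simple_function[OF J(2) sf[OF sU(2)]]
      by (simp add: sU sum_subtractf left_diff_distrib)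
    also have "\<dots> = (\<Sum>v\<in>s i ` space M. \<Sum>f\<in>F. of_real (c f) * (of_real (measure (D f) (?E v)) * v))"
      by (simp add: J(3)[OF m] \<nu>'_def sum_distrib_right mult.assoc)
    also have "\<dots> = (\<Sum>f\<in>F. of_real (c f) * (\<Sum>v\<in>s i ` space M. of_real (measure (D f) (?E v)) * v))"
      by (subst sum.swap) (simp add: sum_distrib_left)
    also have "\<dots> = (\<Sum>f\<in>F. of_real (c f) * (\<integral>x. s i x \<partial>D f))"
      by (intro sum.cong refl) (simp add: integral_simple_function[OF D(1) sf[OF D(2)]] sD)
    finally show ?thesis .
  qed
  have "(\<lambda>i. (\<integral>x. s i x \<partial>U1) - (\<integral>x. s i x \<partial>U2)) \<longlonglongrightarrow> (\<integral>x. h x \<partial>U1) - (\<integral>x. h x \<partial>U2)"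
    by (intro tendsto_diff lim sU J)
  moreover have "(\<lambda>i. (\<integral>x. s i x \<partial>U1) - (\<integral>x. s i x \<partial>U2)) \<longlonglongrightarrow> (\<Sum>f\<in>F. of_real (c f) * (\<integral>x. h x \<partial>D f))"
    unfolding eq by (intro tendsto_sum tendsto_mult tendsto_const lim D)
  ultimately show ?thesis
    unfolding signed_integral_def cong U1_def U2_def by (rule LIMSEQ_unique)
qed

text \<open>
  Uniqueness of signed product measures: rectangles form a generator that is stable under
  intersections, and the sets on which two signed measures agree form a Dynkin system.
\<close>

lemma finite_signed_measure_PiM_eq:
  assumes fin: "finite I" and \<mu>: "finite_signed_measure (Pi\<^sub>M I M) \<mu>" and \<nu>: "finite_signed_measure (Pi\<^sub>M I M) \<nu>"
    and eq: "\<And>A. A \<in> (\<Pi> k\<in>I. sets (M k)) \<Longrightarrow> \<mu> (Pi\<^sub>E I A) = \<nu> (Pi\<^sub>E I A)"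
  shows "\<mu> = \<nu>"
proof
  fix A
  show "\<mu> A = \<nu> A"
  proof (cases "A \<in> sets (Pi\<^sub>M I M)")
    case False then show ?thesis using \<mu> \<nu> by (simp add: finite_signed_measure_def)
  next
    case True
    note Int_stable_prod_algebra[of I M] prod_algebra_sets_into_space[of I M] True[unfolded sets_PiM]
    then show ?thesis
    proof (induction rule: sigma_sets_induct_disjoint)
      case (basic A)
      then obtain X where "A = Pi\<^sub>E I X" "X \<in> (\<Pi> j\<in>I. sets (M j))"
        unfolding prod_algebra_eq_finite[OF fin] by auto
      then show ?case using eq by simp
    next
      case empty then show ?case using \<mu> \<nu> by (simp add: finite_signed_measure_def)
    next
      case (compl A)
      let ?\<Omega> = "\<Pi>\<^sub>E i\<in>I. space (M i)"
      have A: "A \<in> sets (Pi\<^sub>M I M)" using compl(1) by (simp add: sets_PiM)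
      have O: "?\<Omega> = space (Pi\<^sub>M I M)" by (simp add: space_PiM)
      have u: "A \<union> (?\<Omega> - A) = ?\<Omega>" using sets.sets_into_space[OF A] O by auto
      have c: "?\<Omega> - A \<in> sets (Pi\<^sub>M I M)" using A by (auto simp: O)
      have "\<mu> ?\<Omega> = \<mu> A + \<mu> (?\<Omega> - A)" "\<nu> ?\<Omega> = \<nu> A + \<nu> (?\<Omega> - A)"
        using signed_union[OF \<mu> A c] signed_union[OF \<nu> A c] unfolding u by blast+
      moreover have "\<mu> ?\<Omega> = \<nu> ?\<Omega>" by (rule eq) auto
      ultimately show ?case using compl by simp
    next
      case (union A)
      have "range A \<subseteq> sets (Pi\<^sub>M I M)" using union(2) by (simp add: sets_PiM)
      then have "(\<lambda>i. \<mu> (A i)) sums \<mu> (\<Union>i. A i)" "(\<lambda>i. \<nu> (A i)) sums \<nu> (\<Union>i. A i)"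
        using \<mu> \<nu> union(1) by (auto simp: finite_signed_measure_def)
      then show ?case using union(3) sums_unique2 by simp
    qed
  qed
qed

text \<open>
  The product of combinations of point masses is the combination of the point masses at tuples,
  obtained by multiplying out.
\<close>

lemma signed_product_dirac_sums:
  fixes S :: "'s measure" and I :: "'i set" and J :: "'j set"
  assumes fin: "finite I" "finite J" and x: "\<And>j. j \<in> J \<Longrightarrow> x j \<in> space S"
    and \<nu>: "\<And>k A. k \<in> I \<Longrightarrow> A \<in> sets S \<Longrightarrow> \<nu> k A = (\<Sum>j\<in>J. c k j * dirac S (x j) A)"
  shows "signed_product I (\<lambda>_. S) \<nu> =
     (\<lambda>A. \<Sum>f\<in>I \<rightarrow>\<^sub>E J. (\<Prod>k\<in>I. c k (f k)) * measure (return (Pi\<^sub>M I (\<lambda>_. S)) (\<lambda>k\<in>I. x (f k))) A)"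
proof -
  let ?\<mu> = "\<lambda>A. \<Sum>f\<in>I \<rightarrow>\<^sub>E J. (\<Prod>k\<in>I. c k (f k)) * measure (return (Pi\<^sub>M I (\<lambda>_. S)) (\<lambda>k\<in>I. x (f k))) A"
  have pt: "(\<lambda>k\<in>I. x (f k)) \<in> space (Pi\<^sub>M I (\<lambda>_. S))" if "f \<in> I \<rightarrow>\<^sub>E J" for f
    using that x by (auto simp: space_PiM)
  have fsm: "finite_signed_measure (Pi\<^sub>M I (\<lambda>_. S)) ?\<mu>"
    by (rule finite_signed_measure_sum)
       (auto intro!: prob_space.finite_measure prob_space_return pt)
  have rect: "?\<mu> (Pi\<^sub>E I A) = (\<Prod>k\<in>I. \<nu> k (A k))" if A: "A \<in> (\<Pi> k\<in>I. sets S)" for A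
  proof -
    have "Pi\<^sub>E I A \<in> sets (Pi\<^sub>M I (\<lambda>_. S))" using A fin by (intro sets_PiM_I_finite) auto
    then have "?\<mu> (Pi\<^sub>E I A) = (\<Sum>f\<in>I \<rightarrow>\<^sub>E J. (\<Prod>k\<in>I. c k (f k)) * indicator (Pi\<^sub>E I A) (\<lambda>k\<in>I. x (f k)))"
      by (simp add: measure_return)
    also have "\<dots> = (\<Sum>f\<in>I \<rightarrow>\<^sub>E J. \<Prod>k\<in>I. c k (f k) * dirac S (x (f k)) (A k))"
    proof (rule sum.cong[OF refl])
      fix f
      have "(\<Prod>k\<in>I. dirac S (x (f k)) (A k)) = (\<Prod>k\<in>I. indicator (A k) (x (f k)) :: real)"
        using A by (intro prod.cong refl) (auto simp: dirac_def intro!: measure_return)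
      also have "\<dots> = indicator (Pi\<^sub>E I A) (\<lambda>k\<in>I. x (f k))"
        using fin by (auto simp: indicator_def PiE_iff prod_zero_iff)
      finally show "(\<Prod>k\<in>I. c k (f k)) * indicator (Pi\<^sub>E I A) (\<lambda>k\<in>I. x (f k)) = (\<Prod>k\<in>I. c k (f k) * dirac S (x (f k)) (A k))"
        by (simp add: prod.distrib)
    qed
    also have "\<dots> = (\<Prod>k\<in>I. \<Sum>j\<in>J. c k j * dirac S (x j) (A k))"
      using fin by (simp add: prod_sum_PiE)
    also have "\<dots> = (\<Prod>k\<in>I. \<nu> k (A k))"
      using A by (intro prod.cong refl \<nu>[symmetric]) auto
    finally show ?thesis .
  qed
  show ?thesis unfolding signed_product_def
  proof (rule the_equality)
    show "finite_signed_measure (Pi\<^sub>M I (\<lambda>_. S)) ?\<mu> \<and>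
        (\<forall>A\<in>I \<rightarrow> sets S. ?\<mu> (Pi\<^sub>E I A) = (\<Prod>k\<in>I. \<nu> k (A k)))"
      using fsm rect by blast
    fix \<mu> assume "finite_signed_measure (Pi\<^sub>M I (\<lambda>_. S)) \<mu> \<and>
        (\<forall>A\<in>I \<rightarrow> sets S. \<mu> (Pi\<^sub>E I A) = (\<Prod>k\<in>I. \<nu> k (A k)))"
    then show "\<mu> = ?\<mu>"
      by (intro finite_signed_measure_PiM_eq[OF fin(1) _ fsm]) (auto simp only: rect)
  qed
qed

section \<open>Exchangeable samples\<close>

lemma permanent_lists:
  assumes "finite A"
  shows "permanent A ys =
    (\<Sum>js\<in>{js. length js = length ys \<and> distinct js \<and> set js \<subseteq> A}. prod_list (map2 (\<lambda>y j. y j) ys js))"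
  using assms
proof (induction ys arbitrary: A)
  case Nil
  have "{js. length js = length [] \<and> distinct js \<and> set js \<subseteq> A} = {[]}" by auto
  then show ?case by simp
next
  case (Cons y ys)
  let ?D = "\<lambda>A. {js. length js = length ys \<and> distinct js \<and> set js \<subseteq> A}"
  let ?f = "\<lambda>js. prod_list (map2 (\<lambda>y j. y j) ys js)"
  have fin: "finite (?D B)" if "finite B" for B
    by (rule finite_subset[OF _ finite_lists_length_eq[OF that, of "length ys"]]) auto
  have set_eq: "{js. length js = length (y # ys) \<and> distinct js \<and> set js \<subseteq> A}
     = (\<lambda>(j, js). j # js) ` (SIGMA j:A. ?D (A - {j}))"
    by (force simp: length_Suc_conv image_iff)
  have "permanent A (y # ys) = (\<Sum>j\<in>A. \<Sum>js\<in>?D (A - {j}). y j * ?f js)"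
    using Cons by (simp add: sum_distrib_left)
  also have "\<dots> = (\<Sum>(j, js)\<in>(SIGMA j:A. ?D (A - {j})). y j * ?f js)"
    using Cons.prems fin by (intro sum.Sigma) auto
  also have "\<dots> = (\<Sum>js\<in>(\<lambda>(j, js). j # js) ` (SIGMA j:A. ?D (A - {j})). prod_list (map2 (\<lambda>y j. y j) (y # ys) js))"
    by (subst sum.reindex) (auto simp: inj_on_def intro!: sum.cong)
  finally show ?case unfolding set_eq .
qed

lemma permutes_extending:
  assumes fin: "finite A" and I: "I \<subseteq> A" and f: "inj_on f I" "f ` I \<subseteq> A"
  obtains \<pi> where "\<pi> permutes A" "\<And>k. k \<in> I \<Longrightarrow> \<pi> k = f k"
proof -
  have "card (A - I) = card (A - f ` I)"
    using assms finite_subset[OF I fin] by (simp add: card_Diff_subset card_image)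
  then obtain g where g: "bij_betw g (A - I) (A - f ` I)"
    using finite_same_card_bij[OF finite_Diff[OF fin] finite_Diff[OF fin]] by blast
  define \<pi> where "\<pi> = (\<lambda>k. if k \<in> I then f k else if k \<in> A then g k else k)"
  have "bij_betw \<pi> I (f ` I)"
    using f(1) by (auto simp: bij_betw_def \<pi>_def inj_on_def)
  moreover have "bij_betw \<pi> (A - I) (A - f ` I)"
    using g by (subst bij_betw_cong[of _ _ g]) (auto simp: \<pi>_def)
  ultimately have "bij_betw \<pi> (I \<union> (A - I)) (f ` I \<union> (A - f ` I))"
    by (rule bij_betw_combine) auto
  moreover have "I \<union> (A - I) = A" "f ` I \<union> (A - f ` I) = A" using I f by auto
  ultimately have "\<pi> permutes A"
    using I by (intro bij_imp_permutes) (auto simp: \<pi>_def)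
  then show ?thesis using that by (simp add: \<pi>_def)
qed

text \<open>
  A function \<open>f \<in> picks\<close> selects, possibly with repetition, one sample variable for each of the
  \<open>n\<close> coordinates; \<open>law f\<close> is the joint distribution of the selected variables.
\<close>

locale sample = prob_space P
  for P :: "'w measure" and S :: "'s measure" and X :: "nat \<Rightarrow> 'w \<Rightarrow> 's" and N n :: nat +
  assumes X: "\<And>j. j \<in> {1..N} \<Longrightarrow> X j \<in> P \<rightarrow>\<^sub>M S" and n: "1 \<le> n" "n < N"
begin

abbreviation "Sn \<equiv> Pi\<^sub>M {1..n} (\<lambda>_. S)"
abbreviation "picks \<equiv> {1..n} \<rightarrow>\<^sub>E {1..N}"

definition law :: "(nat \<Rightarrow> nat) \<Rightarrow> (nat \<Rightarrow> 's) measure" where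
  "law f = distr P Sn (\<lambda>\<omega>. \<lambda>k\<in>{1..n}. X (f k) \<omega>)"

lemma finite_picks: "finite picks" by (intro finite_PiE) auto

lemma pick_measurable: "f \<in> picks \<Longrightarrow> (\<lambda>\<omega>. \<lambda>k\<in>{1..n}. X (f k) \<omega>) \<in> P \<rightarrow>\<^sub>M Sn"
  by (intro measurable_restrict X) auto

lemma finite_law: "f \<in> picks \<Longrightarrow> finite_measure (law f)"
  unfolding law_def by (rule prob_space.finite_measure[OF prob_space_distr[OF pick_measurable]])

lemma sets_law: "sets (law f) = sets Sn"
  by (simp add: law_def)

text \<open>
  The coefficients \<open>c k j\<close> do not depend on the outcome, so multiplying out the product and taking
  expectations yields a combination of laws with deterministic coefficients.
\<close>

lemma expectation_signed_product:
  assumes A: "A \<in> sets Sn"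
    and \<nu>: "\<And>\<omega> k A. \<omega> \<in> space P \<Longrightarrow> k \<in> {1..n} \<Longrightarrow> A \<in> sets S \<Longrightarrow> \<nu> \<omega> k A = (\<Sum>j\<in>{1..N}. c k j * dirac S (X j \<omega>) A)"
  shows "(\<integral>\<omega>. signed_product {1..n} (\<lambda>_. S) (\<nu> \<omega>) A \<partial>P) = (\<Sum>f\<in>picks. (\<Prod>k\<in>{1..n}. c k (f k)) * measure (law f) A)"
proof -
  let ?X = "\<lambda>f \<omega>. \<lambda>k\<in>{1..n}. X (f k) \<omega>"
  have "(\<integral>\<omega>. signed_product {1..n} (\<lambda>_. S) (\<nu> \<omega>) A \<partial>P)
      = (\<integral>\<omega>. (\<Sum>f\<in>picks. (\<Prod>k\<in>{1..n}. c k (f k)) * indicator (?X f -` A \<inter> space P) \<omega>) \<partial>P)"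
  proof (rule Bochner_Integration.integral_cong[OF refl])
    fix \<omega> assume \<omega>: "\<omega> \<in> space P"
    have "signed_product {1..n} (\<lambda>_. S) (\<nu> \<omega>) = (\<lambda>A. \<Sum>f\<in>picks. (\<Prod>k\<in>{1..n}. c k (f k)) * measure (return Sn (?X f \<omega>)) A)"
      by (rule signed_product_dirac_sums) (use \<omega> X \<nu> in \<open>auto dest: measurable_space\<close>)
    then show "signed_product {1..n} (\<lambda>_. S) (\<nu> \<omega>) A
       = (\<Sum>f\<in>picks. (\<Prod>k\<in>{1..n}. c k (f k)) * indicator (?X f -` A \<inter> space P) \<omega>)"
      using \<omega> A by (simp add: measure_return indicator_def)
  qed
  also have "\<dots> = (\<Sum>f\<in>picks. (\<Prod>k\<in>{1..n}. c k (f k)) * measure P (?X f -` A \<inter> space P))"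
  proof -
    have m: "?X f -` A \<inter> space P \<in> sets P" if "f \<in> picks" for f
      using pick_measurable[OF that] A by (rule measurable_sets)
    then have "integrable P (indicator (?X f -` A \<inter> space P) :: _ \<Rightarrow> real)" if "f \<in> picks" for f
      using that by (intro integrable_real_indicator) (auto simp: less_top[symmetric])
    then show ?thesis
      by (subst Bochner_Integration.integral_sum) (auto intro!: integrable_mult_right sum.cong)
  qed
  also have "\<dots> = (\<Sum>f\<in>picks. (\<Prod>k\<in>{1..n}. c k (f k)) * measure (law f) A)"
  proof (rule sum.cong[OF refl])
    fix f assume f: "f \<in> picks"
    show "(\<Prod>k\<in>{1..n}. c k (f k)) * measure P (?X f -` A \<inter> space P) = (\<Prod>k\<in>{1..n}. c k (f k)) * measure (law f) A"
      by (simp only: law_def measure_distr[OF pick_measurable[OF f] A])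
  qed
  finally show ?thesis .
qed

text \<open>
  The coefficients of the laws of picks in \<open>Q1\<close>; those of the factors \<open>R\<close> and of \<open>Q2\<close>
  follow.
\<close>

definition coeff1 :: "(nat \<Rightarrow> nat) \<Rightarrow> real" where
  "coeff1 f = (\<Prod>k\<in>{1..n}. 1 / real N)"

definition coeffR :: "nat \<Rightarrow> nat set \<Rightarrow> nat \<Rightarrow> nat \<Rightarrow> real" where
  "coeffR j K k i = (if k \<in> K then (if i = j then 1 else 0) - 1 / real N else 1 / real N)"

definition coeff2 :: "(nat \<Rightarrow> nat) \<Rightarrow> real" where
  "coeff2 f = coeff1 f - 1 / (real N * (real N - 1)) *
     (\<Sum>K\<in>{K. K \<subseteq> {1..n} \<and> card K = 2}. \<Sum>j=1..N. \<Prod>k\<in>{1..n}. coeffR j K k (f k))"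

lemma Q1_eq: "A \<in> sets Sn \<Longrightarrow> Q1 P S N n X A = (\<Sum>f\<in>picks. coeff1 f * measure (law f) A)"
  unfolding Q1_def coeff1_def
  by (rule expectation_signed_product) (auto simp: empirical_def sum_distrib_left)

lemma Q2_eq:
  assumes A: "A \<in> sets Sn"
  shows "Q2 P S N n X A = (\<Sum>f\<in>picks. coeff2 f * measure (law f) A)"
proof -
  let ?\<K> = "{K. K \<subseteq> {1..n} \<and> card K = 2}"
  have R: "(\<integral>\<omega>. signed_product {1..n} (\<lambda>_. S) (R S N X j K \<omega>) A \<partial>P)
      = (\<Sum>f\<in>picks. (\<Prod>k\<in>{1..n}. coeffR j K k (f k)) * measure (law f) A)" if j: "j \<in> {1..N}" for j K
  proof (rule expectation_signed_product[OF A])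
    fix \<omega> k A
    have "dirac S (X j \<omega>) A - empirical S N X \<omega> A = (\<Sum>i\<in>{1..N}. ((if i = j then 1 else 0) - 1 / real N) * dirac S (X i \<omega>) A)"
      using j by (simp add: empirical_def left_diff_distrib sum_subtractf sum_distrib_left if_distrib[of "\<lambda>x. x * _"] cong: if_cong)
    then show "R S N X j K \<omega> k A = (\<Sum>i\<in>{1..N}. coeffR j K k i * dirac S (X i \<omega>) A)"
      by (simp add: R_def coeffR_def empirical_def sum_distrib_left)
  qed
  have "(\<Sum>K\<in>?\<K>. \<Sum>j=1..N. \<integral>\<omega>. signed_product {1..n} (\<lambda>_. S) (R S N X j K \<omega>) A \<partial>P)
     = (\<Sum>K\<in>?\<K>. \<Sum>j=1..N. \<Sum>f\<in>picks. (\<Prod>k\<in>{1..n}. coeffR j K k (f k)) * measure (law f) A)"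
    by (intro sum.cong refl R)
  also have "\<dots> = (\<Sum>f\<in>picks. (\<Sum>K\<in>?\<K>. \<Sum>j=1..N. \<Prod>k\<in>{1..n}. coeffR j K k (f k)) * measure (law f) A)"
  proof -
    have "(\<Sum>f\<in>picks. (\<Sum>K\<in>?\<K>. \<Sum>j=1..N. \<Prod>k\<in>{1..n}. coeffR j K k (f k)) * measure (law f) A)
       = (\<Sum>f\<in>picks. \<Sum>K\<in>?\<K>. \<Sum>j=1..N. (\<Prod>k\<in>{1..n}. coeffR j K k (f k)) * measure (law f) A)"
      by (simp only: sum_distrib_right)
    also have "\<dots> = (\<Sum>K\<in>?\<K>. \<Sum>f\<in>picks. \<Sum>j=1..N. (\<Prod>k\<in>{1..n}. coeffR j K k (f k)) * measure (law f) A)"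
      by (rule sum.swap)
    also have "\<dots> = (\<Sum>K\<in>?\<K>. \<Sum>j=1..N. \<Sum>f\<in>picks. (\<Prod>k\<in>{1..n}. coeffR j K k (f k)) * measure (law f) A)"
      by (intro sum.cong refl sum.swap)
    finally show ?thesis by simp
  qed
  finally have R': "(\<Sum>K\<in>?\<K>. \<Sum>j=1..N. \<integral>\<omega>. signed_product {1..n} (\<lambda>_. S) (R S N X j K \<omega>) A \<partial>P)
     = (\<Sum>f\<in>picks. (\<Sum>K\<in>?\<K>. \<Sum>j=1..N. \<Prod>k\<in>{1..n}. coeffR j K k (f k)) * measure (law f) A)" .
  show ?thesis
    unfolding Q2_def Q1_eq[OF A] coeff2_def R'
    by (simp only: left_diff_distrib sum_subtractf sum_distrib_left[symmetric] mult.assoc)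
qed

end

locale product_observable = sample P S X N n
  for P :: "'w measure" and S :: "'s measure" and X N n +
  fixes g :: "nat \<Rightarrow> 's \<Rightarrow> complex"
  assumes exch: "exchangeable P S N X"
    and g: "\<And>k. k \<in> {1..n} \<Longrightarrow> g k \<in> borel_measurable S"
    "\<And>k s. k \<in> {1..n} \<Longrightarrow> s \<in> space S \<Longrightarrow> norm (g k s) \<le> 1"
begin

lemma component_measurable:
  assumes "k \<in> {1..n}" "k \<in> J"
  shows "(\<lambda>x. g k (x k)) \<in> borel_measurable (Pi\<^sub>M J (\<lambda>_. S))"
  by (rule measurable_compose[OF measurable_component_singleton[OF assms(2)] g(1)[OF assms(1)]])

definition Z :: "'w \<Rightarrow> nat \<Rightarrow> nat \<Rightarrow> complex" where
  "Z \<omega> k j = g k (X j \<omega>)"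

lemma Z_measurable: "k \<in> {1..n} \<Longrightarrow> j \<in> {1..N} \<Longrightarrow> (\<lambda>\<omega>. Z \<omega> k j) \<in> borel_measurable P"
  unfolding Z_def by (rule measurable_compose[OF X g(1)])

lemma Z_le: "k \<in> {1..n} \<Longrightarrow> j \<in> {1..N} \<Longrightarrow> \<omega> \<in> space P \<Longrightarrow> norm (Z \<omega> k j) \<le> 1"
  unfolding Z_def by (intro g(2) measurable_space[OF X])

lemma columns_Z: "\<omega> \<in> space P \<Longrightarrow> columns {1..N} (Z \<omega>) N n"
  by unfold_locales (use n Z_le in auto)

lemma integrable_prod_Z:
  assumes "\<And>k. k \<in> {1..n} \<Longrightarrow> f k \<in> {1..N}"
  shows "integrable P (\<lambda>\<omega>. \<Prod>k=1..n. Z \<omega> k (f k))"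
proof (rule integrable_const_bound[where B = 1])
  show "(\<lambda>\<omega>. \<Prod>k=1..n. Z \<omega> k (f k)) \<in> borel_measurable P"
    by (intro borel_measurable_prod Z_measurable assms)
  show "AE \<omega> in P. norm (\<Prod>k=1..n. Z \<omega> k (f k)) \<le> 1"
    by (intro AE_I2) (auto simp: prod_norm[symmetric] intro!: prod_le_1 Z_le assms)
qed

lemma integrable_pick: "f \<in> picks \<Longrightarrow> integrable P (\<lambda>\<omega>. \<Prod>k=1..n. Z \<omega> k (f k))"
  by (rule integrable_prod_Z) (rule PiE_mem)

lemma signed_integral_product:
  assumes h: "\<And>x. x \<in> space Sn \<Longrightarrow> h x = (\<Prod>k=1..n. g k (x k))"
    and \<nu>: "\<And>A. A \<in> sets Sn \<Longrightarrow> \<nu> A = (\<Sum>f\<in>picks. c f * measure (law f) A)"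
  shows "signed_integral Sn \<nu> h = (\<Sum>f\<in>picks. of_real (c f) * (\<integral>\<omega>. (\<Prod>k=1..n. Z \<omega> k (f k)) \<partial>P))"
proof -
  have m: "(\<lambda>x. \<Prod>k=1..n. g k (x k)) \<in> borel_measurable Sn"
    by (intro borel_measurable_prod component_measurable) auto
  then have hm: "h \<in> borel_measurable Sn"
    by (subst measurable_cong[OF h])
  have "signed_integral Sn \<nu> h = (\<Sum>f\<in>picks. of_real (c f) * (\<integral>x. h x \<partial>law f))"
  proof (rule signed_integral_eq_sum[OF finite_picks finite_law sets_law hm _ \<nu>])
    fix x assume x: "x \<in> space Sn"
    have "norm (h x) = (\<Prod>k=1..n. norm (g k (x k)))" by (simp add: h[OF x] prod_norm)
    also have "\<dots> \<le> 1"
      using x by (intro prod_le_1) (auto simp: space_PiM PiE_iff intro!: g(2))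
    finally show "norm (h x) \<le> 1" .
  qed
  also have "\<dots> = (\<Sum>f\<in>picks. of_real (c f) * (\<integral>\<omega>. (\<Prod>k=1..n. Z \<omega> k (f k)) \<partial>P))"
  proof (intro sum.cong refl arg_cong2[where f="(*)"])
    fix f assume f: "f \<in> picks"
    have "(\<integral>x. h x \<partial>law f) = (\<integral>\<omega>. h (\<lambda>k\<in>{1..n}. X (f k) \<omega>) \<partial>P)"
      unfolding law_def by (rule integral_distr[OF pick_measurable[OF f] hm])
    also have "\<dots> = (\<integral>\<omega>. (\<Prod>k=1..n. Z \<omega> k (f k)) \<partial>P)"
    proof (rule Bochner_Integration.integral_cong[OF refl])
      fix \<omega> assume "\<omega> \<in> space P"
      then have "(\<lambda>k\<in>{1..n}. X (f k) \<omega>) \<in> space Sn"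
        using measurable_space[OF pick_measurable[OF f]] by blast
      then show "h (\<lambda>k\<in>{1..n}. X (f k) \<omega>) = (\<Prod>k=1..n. Z \<omega> k (f k))"
        by (simp add: h Z_def)
    qed
    finally show "(\<integral>x. h x \<partial>law f) = (\<integral>\<omega>. (\<Prod>k=1..n. Z \<omega> k (f k)) \<partial>P)" .
  qed
  finally show ?thesis .
qed

text \<open>
  An injective pick extends to a permutation of \<open>{1..N}\<close>.
\<close>

lemma expectation_injective:
  assumes f: "inj_on f {1..n}" "f ` {1..n} \<subseteq> {1..N}"
  shows "(\<integral>\<omega>. (\<Prod>k=1..n. Z \<omega> k (f k)) \<partial>P) = (\<integral>\<omega>. (\<Prod>k=1..n. Z \<omega> k k) \<partial>P)"
proof -
  obtain \<pi> where \<pi>: "\<pi> permutes {1..N}" "\<And>k. k \<in> {1..n} \<Longrightarrow> \<pi> k = f k"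
    using permutes_extending[of "{1..N}" "{1..n}" f] f n by auto
  let ?SN = "Pi\<^sub>M {1..N} (\<lambda>_. S)"
  let ?h = "\<lambda>x. \<Prod>k=1..n. g k (x k)"
  have hm: "?h \<in> borel_measurable ?SN"
    using n by (intro borel_measurable_prod component_measurable) auto
  have tup: "(\<integral>\<omega>. (\<Prod>k=1..n. Z \<omega> k (\<sigma> k)) \<partial>P) = (\<integral>x. ?h x \<partial>distr P ?SN (tuple (\<lambda>i. X (\<sigma> i)) N))"
    if \<sigma>: "\<sigma> permutes {1..N}" for \<sigma>
  proof -
    have "tuple (\<lambda>i. X (\<sigma> i)) N \<in> P \<rightarrow>\<^sub>M ?SN"
      unfolding tuple_def[abs_def]
      by (intro measurable_restrict X) (use permutes_in_image[OF \<sigma>] in auto)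
    then have "(\<integral>x. ?h x \<partial>distr P ?SN (tuple (\<lambda>i. X (\<sigma> i)) N)) = (\<integral>\<omega>. ?h (tuple (\<lambda>i. X (\<sigma> i)) N \<omega>) \<partial>P)"
      by (rule integral_distr[OF _ hm])
    also have "\<dots> = (\<integral>\<omega>. (\<Prod>k=1..n. Z \<omega> k (\<sigma> k)) \<partial>P)"
      using n by (intro Bochner_Integration.integral_cong prod.cong refl) (auto simp: tuple_def Z_def)
    finally show ?thesis by simp
  qed
  have "(\<integral>\<omega>. (\<Prod>k=1..n. Z \<omega> k (f k)) \<partial>P) = (\<integral>\<omega>. (\<Prod>k=1..n. Z \<omega> k (\<pi> k)) \<partial>P)"
    by (intro Bochner_Integration.integral_cong prod.cong refl) (simp add: \<pi>(2))
  also have "\<dots> = (\<integral>\<omega>. (\<Prod>k=1..n. Z \<omega> k (id k)) \<partial>P)"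
    unfolding tup[OF \<pi>(1)] tup[OF permutes_id] using exch \<pi>(1)
    by (simp add: exchangeable_def)
  finally show ?thesis by simp
qed

text \<open>
  The averaged permanent is the mean of \<open>\<Prod>\<^sub>k Z k (f k)\<close> over all injective picks \<open>f\<close>, and these
  products all have the same expectation.
\<close>

lemma permanent_mean_Z:
  shows "integrable P (\<lambda>\<omega>. permanent_mean {1..N} (map (Z \<omega>) [1..<Suc n]))"
    and "(\<integral>\<omega>. permanent_mean {1..N} (map (Z \<omega>) [1..<Suc n]) \<partial>P) = (\<integral>\<omega>. (\<Prod>k=1..n. Z \<omega> k k) \<partial>P)"
proof -
  define D where "D = {js. length js = n \<and> distinct js \<and> set js \<subseteq> {1..N}}"
  define C :: complex where "C = fact (N - n) / fact N"
  define F where "F js = (\<lambda>k. js ! (k - 1) :: nat)" for js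
  have ps: "permanent {1..N} (map w [1..<Suc n]) = (\<Sum>js\<in>D. \<Prod>k=1..n. w k (F js k))" for w
  proof -
    have "prod_list (map2 (\<lambda>y j. y j) (map w [1..<Suc n]) js) = (\<Prod>k=1..n. w k (F js k))" if "js \<in> D" for js
    proof -
      have "map2 (\<lambda>y j. y j) (map w [1..<Suc n]) js = map (\<lambda>k. w k (F js k)) [1..<Suc n]"
        using that by (intro nth_equalityI) (auto simp: D_def F_def simp del: upt_Suc)
      then have "prod_list (map2 (\<lambda>y j. y j) (map w [1..<Suc n]) js) = (\<Prod>k\<in>set [1..<Suc n]. w k (F js k))"
        using prod.distinct_set_conv_list[of "[1..<Suc n]" "\<lambda>k. w k (F js k)"] by (simp del: upt_Suc)
      also have "set [1..<Suc n] = {1..n}" by auto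
      finally show ?thesis .
    qed
    then show ?thesis
      unfolding D_def by (subst permanent_lists) (auto simp del: upt_Suc intro!: sum.cong)
  qed
  have pm: "permanent_mean {1..N} (map w [1..<Suc n]) = (\<Sum>js\<in>D. (\<Prod>k=1..n. w k (F js k)) * C)" for w
    unfolding permanent_mean_def ps by (simp add: C_def sum_distrib_right sum_divide_distrib del: upt_Suc)
  have F: "inj_on (F js) {1..n}" "F js ` {1..n} \<subseteq> {1..N}" if "js \<in> D" for js
  proof -
    show "inj_on (F js) {1..n}"
      using that by (auto simp: inj_on_def F_def D_def nth_eq_iff_index_eq)
    show "F js ` {1..n} \<subseteq> {1..N}"
      using that nth_mem[of _ js] unfolding F_def D_def by fastforce
  qed
  have int: "integrable P (\<lambda>\<omega>. (\<Prod>k=1..n. Z \<omega> k (F js k)) * C)" if "js \<in> D" for js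
    by (intro integrable_mult_left integrable_prod_Z) (use F(2)[OF that] in blast)
  show "integrable P (\<lambda>\<omega>. permanent_mean {1..N} (map (Z \<omega>) [1..<Suc n]))"
    unfolding pm by (intro Bochner_Integration.integrable_sum int)
  \<comment> \<open>The number of tuples is read off from the permanent of columns of ones.\<close>
  have one: "of_nat (card D) * C = 1"
  proof -
    have "permanent_mean {1..N} (map (\<lambda>_ _. 1) [1..<Suc n]) = of_nat (card D) * C"
      unfolding pm by simp
    moreover have "map (\<lambda>_ _. 1) [1..<Suc n] = [] @ replicate n (\<lambda>_::nat. 1::complex)"
      by (simp add: map_replicate_const del: upt_Suc)
    ultimately show ?thesis
      using permanent_mean_ones[of "{1..N}" "[]" n] n by (simp add: permanent_mean_def del: upt_Suc)
  qed
  have "(\<integral>\<omega>. permanent_mean {1..N} (map (Z \<omega>) [1..<Suc n]) \<partial>P) = (\<Sum>js\<in>D. (\<integral>\<omega>. (\<Prod>k=1..n. Z \<omega> k (F js k)) \<partial>P) * C)"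
    unfolding pm by (simp only: Bochner_Integration.integral_sum[OF int] integral_mult_left_zero)
  also have "\<dots> = (\<Sum>js\<in>D. (\<integral>\<omega>. (\<Prod>k=1..n. Z \<omega> k k) \<partial>P) * C)"
    by (intro sum.cong refl arg_cong2[where f="(*)"] expectation_injective F)
  also have "\<dots> = (of_nat (card D) * C) * (\<integral>\<omega>. (\<Prod>k=1..n. Z \<omega> k k) \<partial>P)"
    by simp
  finally show "(\<integral>\<omega>. permanent_mean {1..N} (map (Z \<omega>) [1..<Suc n]) \<partial>P) = (\<integral>\<omega>. (\<Prod>k=1..n. Z \<omega> k k) \<partial>P)"
    unfolding one by simp
qed

text \<open>
  A signed measure \<open>Q\<close> that is a combination of laws of picks integrates the product function
  to the expectation of the corresponding combination of products. It is thus enough to compare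
  the latter with the averaged permanent, outcome by outcome.
\<close>

lemma signed_integral_bound:
  assumes h: "\<And>x. x \<in> space Sn \<Longrightarrow> h x = (\<Prod>k=1..n. g k (x k))"
    and Q: "\<And>A. A \<in> sets Sn \<Longrightarrow> Q A = (\<Sum>f\<in>picks. c f * measure (law f) A)"
    and B: "\<And>\<omega>. \<omega> \<in> space P \<Longrightarrow> norm (permanent_mean {1..N} (map (Z \<omega>) [1..<Suc n])
        - (\<Sum>f\<in>picks. of_real (c f) * (\<Prod>k=1..n. Z \<omega> k (f k)))) \<le> B"
  shows "norm (signed_integral Sn (\<lambda>A. measure (distr P Sn (tuple X n)) A - Q A) h) \<le> B"
proof -
  let ?E = "\<lambda>f. \<integral>\<omega>. (\<Prod>k=1..n. Z \<omega> k (f k)) \<partial>P"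
  let ?T = "\<lambda>\<omega>. permanent_mean {1..N} (map (Z \<omega>) [1..<Suc n])"
  let ?W = "\<lambda>\<omega>. \<Sum>f\<in>picks. of_real (c f) * (\<Prod>k=1..n. Z \<omega> k (f k))"
  have int: "integrable P (\<lambda>\<omega>. of_real (c f) * (\<Prod>k=1..n. Z \<omega> k (f k)))" if "f \<in> picks" for f
    by (rule integrable_mult_right) (rule integrable_pick[OF that])
  have intW: "integrable P ?W"
    by (rule Bochner_Integration.integrable_sum) (rule int)
  \<comment> \<open>The law of \<open>(X\<^sub>1,\<dots>,X\<^sub>n)\<close> belongs to the identity pick.\<close>
  define i where "i = (\<lambda>k\<in>{1..n}. k)"
  have i: "i \<in> picks" using n by (auto simp: i_def)
  have "distr P Sn (tuple X n) = law i"
    unfolding law_def tuple_def[abs_def] i_def by (intro arg_cong[where f="distr P Sn"] ext restrict_ext) auto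
  then have "signed_integral Sn (\<lambda>A. measure (distr P Sn (tuple X n)) A - Q A) h
     = (\<Sum>f\<in>picks. of_real ((if f = i then 1 else 0) - c f) * ?E f)"
    using i finite_picks
    by (intro signed_integral_product h)
       (simp_all add: Q left_diff_distrib sum_subtractf if_distrib[of "\<lambda>x. x * _"] cong: if_cong)
  also have "\<dots> = ?E i - (\<Sum>f\<in>picks. of_real (c f) * ?E f)"
    using i finite_picks
    by (simp add: left_diff_distrib sum_subtractf if_distrib[of "\<lambda>x. x * _"] if_distrib[of of_real] cong: if_cong)
  also have "?E i = (\<integral>\<omega>. permanent_mean {1..N} (map (Z \<omega>) [1..<Suc n]) \<partial>P)"
    unfolding permanent_mean_Z(2)
    by (intro Bochner_Integration.integral_cong prod.cong refl) (auto simp: i_def)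
  also have "(\<Sum>f\<in>picks. of_real (c f) * ?E f) = (\<integral>\<omega>. ?W \<omega> \<partial>P)"
    by (simp only: Bochner_Integration.integral_sum[OF int] integral_mult_right_zero)
  also have "(\<integral>\<omega>. ?T \<omega> \<partial>P) - \<dots> = (\<integral>\<omega>. ?T \<omega> - ?W \<omega> \<partial>P)"
    by (rule Bochner_Integration.integral_diff[symmetric, OF permanent_mean_Z(1) intW])
  finally have eq: "signed_integral Sn (\<lambda>A. measure (distr P Sn (tuple X n)) A - Q A) h = (\<integral>\<omega>. ?T \<omega> - ?W \<omega> \<partial>P)" .
  have "norm (signed_integral Sn (\<lambda>A. measure (distr P Sn (tuple X n)) A - Q A) h) \<le> (\<integral>\<omega>. norm (?T \<omega> - ?W \<omega>) \<partial>P)"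
    unfolding eq by (rule integral_norm_bound)
  also have "\<dots> \<le> B"
  proof (rule integral_le_const)
    show "integrable P (\<lambda>\<omega>. norm (?T \<omega> - ?W \<omega>))"
      by (rule integrable_norm[OF Bochner_Integration.integrable_diff[OF permanent_mean_Z(1) intW]])
    show "AE \<omega> in P. norm (?T \<omega> - ?W \<omega>) \<le> B" by (rule AE_I2) (rule B)
  qed
  finally show ?thesis .
qed

text \<open>
  Coefficients of product form factor back into a product of sums over \<open>{1..N}\<close>.
\<close>

lemma sum_picks: "(\<Sum>f\<in>picks. of_real (\<Prod>k=1..n. c k (f k)) * (\<Prod>k=1..n. Z \<omega> k (f k)))
   = (\<Prod>k=1..n. \<Sum>j=1..N. of_real (c k j) * Z \<omega> k j)"
  by (simp add: prod_sum_PiE prod.distrib)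

lemma picks_coeff1:
  assumes "\<omega> \<in> space P"
  shows "(\<Sum>f\<in>picks. of_real (coeff1 f) * (\<Prod>k=1..n. Z \<omega> k (f k))) = (\<Prod>k=1..n. columns.m {1..N} (Z \<omega>) N k)"
proof -
  have "(\<Sum>f\<in>picks. of_real (coeff1 f) * (\<Prod>k=1..n. Z \<omega> k (f k)))
      = (\<Prod>k=1..n. \<Sum>j=1..N. of_real (1 / real N) * Z \<omega> k j)"
    unfolding coeff1_def by (rule sum_picks)
  then show ?thesis
    unfolding columns.m_def[OF columns_Z[OF assms]] by (simp add: sum_divide_distrib)
qed

lemma picks_coeff2:
  assumes \<omega>: "\<omega> \<in> space P"
  shows "(\<Sum>f\<in>picks. of_real (coeff2 f) * (\<Prod>k=1..n. Z \<omega> k (f k))) =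
    (\<Prod>k=1..n. columns.m {1..N} (Z \<omega>) N k) -
    (\<Sum>K\<in>{K. K \<subseteq> {1..n} \<and> card K = 2}. \<Sum>i\<in>{1..N}. (\<Prod>k\<in>K. columns.y {1..N} (Z \<omega>) N k i)
        * (\<Prod>k\<in>{1..n} - K. columns.m {1..N} (Z \<omega>) N k)) / (of_nat N * (of_nat N - 1))"
proof -
  interpret columns "{1..N}" "Z \<omega>" N n by (rule columns_Z[OF \<omega>])
  let ?\<K> = "{K. K \<subseteq> {1..n} \<and> card K = 2}"
  have R: "(\<Sum>f\<in>picks. of_real (\<Prod>k=1..n. coeffR j K k (f k)) * (\<Prod>k=1..n. Z \<omega> k (f k)))
      = (\<Prod>k\<in>K. y k j) * (\<Prod>k\<in>{1..n} - K. m k)" if "K \<in> ?\<K>" "j \<in> {1..N}" for K j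
  proof -
    have K: "K \<subseteq> {1..n}" using that by simp
    have "(\<Sum>i=1..N. of_real (coeffR j K k i) * Z \<omega> k i) = (if k \<in> K then y k j else m k)" for k
    proof -
      have "(\<Sum>i=1..N. of_real ((if i = j then 1 else 0) - 1 / real N) * Z \<omega> k i) = y k j"
        unfolding y_def m_def
        using that(2) by (simp add: left_diff_distrib sum_subtractf sum_divide_distrib
            if_distrib[of "\<lambda>x. x * _"] if_distrib[of of_real] cong: if_cong)
      moreover have "(\<Sum>i=1..N. of_real (1 / real N) * Z \<omega> k i) = m k"
        unfolding m_def by (simp add: sum_divide_distrib)
      ultimately show ?thesis unfolding coeffR_def by (cases "k \<in> K") simp_all
    qed
    then have "(\<Sum>f\<in>picks. of_real (\<Prod>k=1..n. coeffR j K k (f k)) * (\<Prod>k=1..n. Z \<omega> k (f k)))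
       = (\<Prod>k=1..n. if k \<in> K then y k j else m k)"
      unfolding sum_picks by simp
    also have "\<dots> = (\<Prod>k\<in>{1..n} - K. if k \<in> K then y k j else m k) * (\<Prod>k\<in>K. if k \<in> K then y k j else m k)"
      by (rule prod.subset_diff[OF K]) simp
    finally show ?thesis by (simp add: mult.commute)
  qed
  let ?d = "of_nat N * (of_nat N - 1) :: complex"
  have "(\<Sum>f\<in>picks. of_real (coeff2 f) * (\<Prod>k=1..n. Z \<omega> k (f k))) =
     (\<Sum>f\<in>picks. of_real (coeff1 f) * (\<Prod>k=1..n. Z \<omega> k (f k)))
     - (\<Sum>f\<in>picks. \<Sum>K\<in>?\<K>. \<Sum>j=1..N. of_real (\<Prod>k=1..n. coeffR j K k (f k)) * (\<Prod>k=1..n. Z \<omega> k (f k))) / ?d"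
    unfolding sum_divide_distrib sum_subtractf[symmetric]
  proof (rule sum.cong[OF refl])
    fix f
    show "of_real (coeff2 f) * (\<Prod>k=1..n. Z \<omega> k (f k)) =
       of_real (coeff1 f) * (\<Prod>k=1..n. Z \<omega> k (f k)) -
       (\<Sum>K\<in>?\<K>. \<Sum>j=1..N. of_real (\<Prod>k=1..n. coeffR j K k (f k)) * (\<Prod>k=1..n. Z \<omega> k (f k)) / ?d)"
      unfolding coeff2_def sum_divide_distrib[symmetric] sum_distrib_right[symmetric]
      by (simp add: left_diff_distrib)
  qed
  also have "(\<Sum>f\<in>picks. \<Sum>K\<in>?\<K>. \<Sum>j=1..N. of_real (\<Prod>k=1..n. coeffR j K k (f k)) * (\<Prod>k=1..n. Z \<omega> k (f k)))
     = (\<Sum>K\<in>?\<K>. \<Sum>j=1..N. \<Sum>f\<in>picks. of_real (\<Prod>k=1..n. coeffR j K k (f k)) * (\<Prod>k=1..n. Z \<omega> k (f k)))"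
    by (subst sum.swap) (intro sum.cong refl sum.swap)
  also have "\<dots> = (\<Sum>K\<in>?\<K>. \<Sum>j=1..N. (\<Prod>k\<in>K. y k j) * (\<Prod>k\<in>{1..n} - K. m k))"
    by (intro sum.cong refl R)
  finally show ?thesis unfolding picks_coeff1[OF \<omega>] .
qed

end

theorem theorem1p1:
  fixes P :: "'w measure" and S :: "'s measure"
    and X :: "nat \<Rightarrow> 'w \<Rightarrow> 's" and N n :: nat
  assumes "N \<ge> 1" and "n \<in> {1..N}" and "real n / real N < 1"
    and "prob_space P"
    and "\<And>j. j \<in> {1..N} \<Longrightarrow> X j \<in> P \<rightarrow>\<^sub>M S"
    and "exchangeable P S N X"
  defines "PY \<equiv> distr P (Pi\<^sub>M {1..n} (\<lambda>_. S)) (tuple X n)"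
  shows
    "(SUP f\<in>product_functions S n.
        ereal (norm (signed_integral (Pi\<^sub>M {1..n} (\<lambda>_. S))
          (\<lambda>A. measure PY A - Q1 P S N n X A) f)))
      \<le> ereal (real n / real N +
          2.12 * ((real n / real N) powr (3/2) / (1 - real n / real N) powr (3/4))) \<and>
     (n \<ge> 2 \<longrightarrow>
      (SUP f\<in>product_functions S n.
        ereal (norm (signed_integral (Pi\<^sub>M {1..n} (\<lambda>_. S))
          (\<lambda>A. measure PY A - Q2 P S N n X A) f)))
      \<le> ereal (sqrt 3 * (real n / real N) powr (3/2) +
          2.27 * ((real n / real N)\<^sup>2 / (1 - real n / real N) powr (3/4))))"
proof -
  interpret prob_space P by fact
  interpret sample P S X N n
    by unfold_locales (use assms(1,2,3,5) in auto)
  have exch: "exchangeable P S N X" by fact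
  show ?thesis
  proof (intro conjI impI SUP_least; unfold ereal_less_eq)
    fix h assume "h \<in> product_functions S n"
    then obtain g where g: "\<And>k. k \<in> {1..n} \<Longrightarrow> g k \<in> borel_measurable S"
        "\<And>k s. k \<in> {1..n} \<Longrightarrow> s \<in> space S \<Longrightarrow> norm (g k s) \<le> 1"
      and h: "\<And>x. x \<in> space Sn \<Longrightarrow> h x = (\<Prod>k=1..n. g k (x k))"
      unfolding product_functions_def by blast
    interpret product_observable P S X N n g
      by unfold_locales (use exch g in auto)
    show "norm (signed_integral Sn (\<lambda>A. measure PY A - Q1 P S N n X A) h)
        \<le> real n / real N + 2.12 * ((real n / real N) powr (3/2) / (1 - real n / real N) powr (3/4))"
      unfolding PY_def
    proof (rule signed_integral_bound[OF h Q1_eq])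
      fix \<omega> assume \<omega>: "\<omega> \<in> space P"
      show "norm (permanent_mean {1..N} (map (Z \<omega>) [1..<Suc n]) - (\<Sum>f\<in>picks. of_real (coeff1 f) * (\<Prod>k=1..n. Z \<omega> k (f k))))
        \<le> real n / real N + 2.12 * ((real n / real N) powr (3/2) / (1 - real n / real N) powr (3/4))"
        unfolding picks_coeff1[OF \<omega>] by (rule columns.first_order[OF columns_Z[OF \<omega>]])
    qed
    show "norm (signed_integral Sn (\<lambda>A. measure PY A - Q2 P S N n X A) h)
        \<le> sqrt 3 * (real n / real N) powr (3/2) + 2.27 * ((real n / real N)\<^sup>2 / (1 - real n / real N) powr (3/4))"
      unfolding PY_def
    proof (rule signed_integral_bound[OF h Q2_eq])
      fix \<omega> assume \<omega>: "\<omega> \<in> space P"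
      have 1: "a - (b - c) = a - b + c" for a b c :: complex by simp
      show "norm (permanent_mean {1..N} (map (Z \<omega>) [1..<Suc n]) - (\<Sum>f\<in>picks. of_real (coeff2 f) * (\<Prod>k=1..n. Z \<omega> k (f k))))
        \<le> sqrt 3 * (real n / real N) powr (3/2) + 2.27 * ((real n / real N)\<^sup>2 / (1 - real n / real N) powr (3/4))"
        unfolding picks_coeff2[OF \<omega>] 1 by (rule columns.second_order[OF columns_Z[OF \<omega>]])
    qed
  qed
qed

end
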